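(* Let $(A,\mathfrak m)$ be a Noetherian local ring and $F$ a free $A$-module of rank $r>0$. Let $N$ be a submodule of $F$ generated by $c_1,\dots,c_n$, where $n=\mu_A(N)$. Assume $n>r$. Put $M=N:_F\mathfrak m$, the socle module of $N$. Assume that (1) the matrix $\tilde N$ is perfect, (2) $N\subseteq\mathfrak m F$, and (3) $\operatorname{depth} A>0$. Then the equality $M^2=NM$ holds if $A$ is not a regular local ring.
   Context: $\mu_A(-)$ denotes the minimal number of generators. $N:_F\mathfrak m=\{f\in F:\mathfrak m f\subseteq N\}$. Fix a free basis $t_1,\dots,t_r$ of $F$; the $r\times n$ matrix $\tilde N=(c_{ij})$ associated to $N$ (with generators $c_1,\dots,c_n$) is defined by $c_j=c_{1j}t_1+\cdots+c_{rj}t_r$, $c_{ij}\in A$. For integers $n\ge r>0$, an $r\times n$ matrix $\varphi$ over $A$ is called perfect if (i) $I_r(\varphi)\subsetneq A$ and (ii) $\operatorname{grade} I_r(\varphi)=n-r+1$ (the greatest possible value), where $I_r(\varphi)$ is the ideal generated by the $r\times r$ minors of $\varphi$ and the grade of an ideal is the maximal length of an $A$-regular sequence in it. Let $S=\operatorname{Sym}_A(F)=A[t_1,\dots,t_r]$, with $F$ identified with $S_1$. Products and powers of submodules of $F$ are taken inside $S$: $NM$ is the $A$-submodule of $S_2$ generated by all $xy$ with $x\in N$, $y\in M$, and $M^2=MM$. *)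

theory Defs
  imports
    "Jordan_Normal_Form.Determinant"
    "Jordan_Normal_Form.DL_Submatrix"
    "HOL-Library.Poly_Mapping"
    "HOL-Library.Extended_Nat"
begin

text \<open>
  The ring \<open>A\<close> is a type of class \<open>comm_ring_1\<close>; \<open>A\<close>-modules are types with a scalar
  multiplication satisfying the locale \<open>Modules.module\<close> of \<open>HOL.Modules\<close> (the qualifier is needed
  because HOL-Algebra also has a locale \<open>module\<close>). Ideals are the submodules of \<open>A\<close> acting on
  itself by multiplication.
\<close>

lemma module_times: "Modules.module ((*) :: 'a::comm_ring_1 \<Rightarrow> 'a \<Rightarrow> 'a)"
  by (unfold_locales) (auto simp: algebra_simps)


section \<open>Commutative algebra of a ring given as a type\<close>

definition is_ideal :: "'a::comm_ring_1 set \<Rightarrow> bool" where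
  "is_ideal I \<longleftrightarrow> Modules.module.subspace (*) I"

definition ideal_span :: "'a::comm_ring_1 set \<Rightarrow> 'a set" where
  "ideal_span X = Modules.module.span (*) X"

definition is_prime_ideal :: "'a::comm_ring_1 set \<Rightarrow> bool" where
  "is_prime_ideal P \<longleftrightarrow> is_ideal P \<and> P \<noteq> UNIV \<and> (\<forall>a b. a * b \<in> P \<longrightarrow> a \<in> P \<or> b \<in> P)"

definition is_maximal_ideal :: "'a::comm_ring_1 set \<Rightarrow> bool" where
  "is_maximal_ideal M \<longleftrightarrow> is_ideal M \<and> M \<noteq> UNIV \<and>
     (\<forall>J. is_ideal J \<and> M \<subseteq> J \<longrightarrow> J = M \<or> J = UNIV)"

definition noetherian :: "'a::comm_ring_1 itself \<Rightarrow> bool" where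
  "noetherian _ \<longleftrightarrow> (\<forall>I::'a set. is_ideal I \<longrightarrow> (\<exists>X. finite X \<and> I = ideal_span X))"

definition noetherian_local :: "'a::comm_ring_1 set \<Rightarrow> bool" where
  "noetherian_local \<mm> \<longleftrightarrow> noetherian TYPE('a) \<and> {M. is_maximal_ideal M} = {\<mm>}"

text \<open>The value is \<open>\<infinity>\<close> if \<open>N\<close> is not finitely generated.\<close>

definition min_gens :: "('a::comm_ring_1 \<Rightarrow> 'f::ab_group_add \<Rightarrow> 'f) \<Rightarrow> 'f set \<Rightarrow> enat" where
  "min_gens scale N = Inf {enat (card X) | X. finite X \<and> Modules.module.span scale X = N}"

definition krull_dim :: "'a::comm_ring_1 itself \<Rightarrow> enat" where
  "krull_dim _ = Sup {enat k | k. \<exists>P :: nat \<Rightarrow> 'a set.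
     (\<forall>i\<le>k. is_prime_ideal (P i)) \<and> (\<forall>i<k. P i \<subset> P (Suc i))}"

definition regular_local :: "'a::comm_ring_1 set \<Rightarrow> bool" where
  "regular_local \<mm> \<longleftrightarrow> noetherian_local \<mm> \<and> krull_dim TYPE('a) = min_gens (*) \<mm>"

text \<open>Each \<open>x\<^sub>k\<close> is a nonzerodivisor on \<open>A/(x\<^sub>0,\<dots>,x\<^bsub>k-1\<^esub>)\<close>, and \<open>(x\<^sub>0,x\<^sub>1,\<dots>) \<noteq> A\<close>.\<close>

definition regular_seq :: "'a::comm_ring_1 list \<Rightarrow> bool" where
  "regular_seq xs \<longleftrightarrow> ideal_span (set xs) \<noteq> UNIV \<and>
     (\<forall>k<length xs. \<forall>a. xs ! k * a \<in> ideal_span (set (take k xs)) \<longrightarrow>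
        a \<in> ideal_span (set (take k xs)))"

definition grade :: "'a::comm_ring_1 set \<Rightarrow> enat" where
  "grade I = Sup {enat (length xs) | xs. set xs \<subseteq> I \<and> regular_seq xs}"

text \<open>For a local ring with maximal ideal \<open>\<mm>\<close>, the depth of the ring is the grade of \<open>\<mm>\<close>.\<close>

definition depth_local :: "'a::comm_ring_1 set \<Rightarrow> enat" where
  "depth_local \<mm> = grade \<mm>"


section \<open>Perfect matrices\<close>

definition minors_ideal :: "'a::comm_ring_1 mat \<Rightarrow> 'a set" where
  "minors_ideal \<phi> = ideal_span
     {det (submatrix \<phi> {..<dim_row \<phi>} J) | J. J \<subseteq> {..<dim_col \<phi>} \<and> card J = dim_row \<phi>}"

definition perfect_mat :: "'a::comm_ring_1 mat \<Rightarrow> bool" where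
  "perfect_mat \<phi> \<longleftrightarrow> 0 < dim_row \<phi> \<and> dim_row \<phi> \<le> dim_col \<phi> \<and>
     minors_ideal \<phi> \<noteq> UNIV \<and>
     grade (minors_ideal \<phi>) = enat (dim_col \<phi> - dim_row \<phi> + 1)"


section \<open>Submodules of a free module and their products in the symmetric algebra\<close>

definition free_basis ::
    "('a::comm_ring_1 \<Rightarrow> 'f::ab_group_add \<Rightarrow> 'f) \<Rightarrow> nat \<Rightarrow> (nat \<Rightarrow> 'f) \<Rightarrow> bool" where
  "free_basis scale r t \<longleftrightarrow> inj_on t {..<r} \<and>
     \<not> Modules.module.dependent scale (t ` {..<r}) \<and>
     Modules.module.span scale (t ` {..<r}) = UNIV"

definition coord ::
    "('a::comm_ring_1 \<Rightarrow> 'f::ab_group_add \<Rightarrow> 'f) \<Rightarrow> nat \<Rightarrow> (nat \<Rightarrow> 'f) \<Rightarrow> 'f \<Rightarrow> nat \<Rightarrow> 'a" where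
  "coord scale r t f i = Modules.module.representation scale (t ` {..<r}) f (t i)"

definition assoc_mat ::
    "('a::comm_ring_1 \<Rightarrow> 'f::ab_group_add \<Rightarrow> 'f) \<Rightarrow> nat \<Rightarrow> (nat \<Rightarrow> 'f) \<Rightarrow>
       nat \<Rightarrow> (nat \<Rightarrow> 'f) \<Rightarrow> 'a mat" where
  "assoc_mat scale r t n c = mat r n (\<lambda>(i, j). coord scale r t (c j) i)"

definition ideal_smult ::
    "('a::comm_ring_1 \<Rightarrow> 'f::ab_group_add \<Rightarrow> 'f) \<Rightarrow> 'a set \<Rightarrow> 'f set \<Rightarrow> 'f set" where
  "ideal_smult scale I N = Modules.module.span scale {scale a x | a x. a \<in> I \<and> x \<in> N}"

definition module_colon ::
    "('a::comm_ring_1 \<Rightarrow> 'f::ab_group_add \<Rightarrow> 'f) \<Rightarrow> 'f set \<Rightarrow> 'a set \<Rightarrow> 'f set" where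
  "module_colon scale N I = {f. \<forall>a\<in>I. scale a f \<in> N}"

text \<open>
  Polynomials over \<open>A\<close> in variables indexed by \<open>nat\<close>. For a free module \<open>F\<close> of rank \<open>r\<close>, the
  symmetric algebra \<open>S = A[t\<^sub>0,\<dots>,t\<^bsub>r-1\<^esub>]\<close> is the subring of polynomials in the first \<open>r\<close> variables;
  all products of elements of \<open>F\<close>, and the \<open>A\<close>-submodules they span, lie in it.
\<close>

type_synonym 'a polys = "(nat \<Rightarrow>\<^sub>0 nat) \<Rightarrow>\<^sub>0 'a"

definition poly_scale :: "'a::comm_ring_1 \<Rightarrow> 'a polys \<Rightarrow> 'a polys" where
  "poly_scale a p = Poly_Mapping.single 0 a * p"

lemma module_poly_scale: "Modules.module (poly_scale :: 'a::comm_ring_1 \<Rightarrow> 'a polys \<Rightarrow> 'a polys)"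
  by unfold_locales
    (simp_all add: poly_scale_def algebra_simps single_add mult_single mult.assoc [symmetric])

text \<open>The identification of \<open>F\<close> with \<open>S\<^sub>1\<close>: the basis element \<open>t i\<close> goes to the \<open>i\<close>-th variable.\<close>

definition sym_embed ::
    "('a::comm_ring_1 \<Rightarrow> 'f::ab_group_add \<Rightarrow> 'f) \<Rightarrow> nat \<Rightarrow> (nat \<Rightarrow> 'f) \<Rightarrow> 'f \<Rightarrow> 'a polys" where
  "sym_embed scale r t f =
     (\<Sum>i<r. poly_scale (coord scale r t f i) (Poly_Mapping.single (Poly_Mapping.single i 1) 1))"

text \<open>The product \<open>NM\<close> of submodules of \<open>F\<close>, as an \<open>A\<close>-submodule of \<open>S\<^sub>2\<close>.\<close>

definition sym_prod ::
    "('a::comm_ring_1 \<Rightarrow> 'f::ab_group_add \<Rightarrow> 'f) \<Rightarrow> nat \<Rightarrow> (nat \<Rightarrow> 'f) \<Rightarrow>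
       'f set \<Rightarrow> 'f set \<Rightarrow> 'a polys set" where
  "sym_prod scale r t N M = Modules.module.span poly_scale
     {sym_embed scale r t x * sym_embed scale r t y | x y. x \<in> N \<and> y \<in> M}"

end

theory Submission
imports Defs "HOL-Library.Function_Algebras"
begin

text \<open>
  Everything rests on one fact about the columns \<open>c\<^sub>1, \<dots>, c\<^sub>n\<close> of the matrix: the entries of a syzygy
  \<open>\<Sum>\<^sub>j u\<^sub>j c\<^sub>j = 0\<close> are special. By the exactness of the Buchsbaum-Rim complex at its first step, the vector
  \<open>u\<close> is the image of an element of the exterior power of degree \<open>r + 1\<close> under the composite of the \<open>r\<close>
  contractions with the rows. Hence every \<open>u\<^sub>j\<close> kills \<open>F/N\<close> (lemma \<open>syzygy_annihilates\<close>), lies in \<open>\<mm>\<^sup>2\<close>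
  if \<open>r \<ge> 2\<close>, and lies in the ideal of the other columns if \<open>r = 1\<close>.
  
  First consequence: \<open>\<mm>M \<subseteq> \<mm>N\<close> and \<open>M \<subseteq> \<mm>F\<close> (lemmas \<open>socle_coefficients\<close>, \<open>socle_in_maximal\<close>). Suppose that
  \<open>x \<in> M\<close>, \<open>z \<in> \<mm>\<close> and \<open>z x = \<Sum>\<^sub>j u\<^sub>j c\<^sub>j\<close> with a unit \<open>u\<^sub>i\<close>. For \<open>w \<in> \<mm>\<close> write \<open>w x = \<Sum>\<^sub>j s\<^sub>j c\<^sub>j\<close>; then
  \<open>z s\<^sub>j - w u\<^sub>j\<close> is a syzygy, so \<open>w\<close> lies in \<open>(z) + \<mm>\<^sup>2\<close> if \<open>r \<ge> 2\<close>. Then \<open>\<mm> = (z)\<close> by Nakayama, which is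
  incompatible with a regular sequence of length \<open>n - r + 1 \<ge> 2\<close> in \<open>\<mm>\<close>. If \<open>r = 1\<close> then \<open>\<mm>\<close> is generated by \<open>z\<close> and
  the columns other than \<open>c\<^sub>i\<close>, that is by \<open>n\<close> elements, and it contains a regular sequence of length \<open>n\<close>;
  by Krull's height theorem \<open>A\<close> is regular, contrary to the hypothesis.
  
  Second consequence: \<open>M\<^sup>2 \<subseteq> NM\<close>. Let \<open>x, y \<in> M\<close>, with \<open>y = \<Sum>\<^sub>k y\<^sub>k t\<^sub>k\<close>. The \<open>y\<^sub>k\<close> lie in \<open>\<mm>\<close>, so
  \<open>y\<^sub>k x = \<Sum>\<^sub>i b\<^sub>k\<^sub>i c\<^sub>i\<close> and \<open>x y = \<Sum>\<^sub>i c\<^sub>i g\<^sub>i\<close> with \<open>g\<^sub>i = \<Sum>\<^sub>k b\<^sub>k\<^sub>i t\<^sub>k\<close>. It remains to see that \<open>g\<^sub>i \<in> M\<close>. For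
  \<open>z \<in> \<mm>\<close> write \<open>z x = \<Sum>\<^sub>i u\<^sub>i c\<^sub>i\<close> with \<open>u\<^sub>i \<in> \<mm>\<close>. For each \<open>k\<close> the vector \<open>z b\<^sub>k\<^sub>i - u\<^sub>i y\<^sub>k\<close> (indexed by \<open>i\<close>) is a
  syzygy, because both parts yield \<open>z y\<^sub>k x\<close>. Its entries kill \<open>F/N\<close>, so \<open>z g\<^sub>i \<equiv> u\<^sub>i y \<equiv> 0\<close> modulo \<open>N\<close>.
  
  The exactness itself (theorem \<open>first_syzygies\<close>) is an instance of the acyclicity lemma. An \<open>x\<close> that kills \<open>F/N\<close>
  gives an explicit homotopy, so a power of \<open>x\<close> kills the homology of the Buchsbaum-Rim complex, also
  modulo any ideal. Along a regular sequence \<open>x\<^sub>1, x\<^sub>2, \<dots>\<close> of such elements, the exactness modulo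
  \<open>(x\<^sub>1, \<dots>, x\<^bsub>i+1\<^esub>)\<close> one step further to the left implies the exactness modulo \<open>(x\<^sub>1, \<dots>, x\<^sub>i)\<close>
  (lemma \<open>boundary_cancel\<close>). The complex ends after \<open>n - r + 1\<close> steps, which is the length of the regular
  sequence provided by perfection.
\<close>

section \<open>Ideals of a ring\<close>

lemma is_ideal_zero: "is_ideal J \<Longrightarrow> 0 \<in> J"
  and is_ideal_add: "is_ideal J \<Longrightarrow> a \<in> J \<Longrightarrow> b \<in> J \<Longrightarrow> a + b \<in> J"
  and is_ideal_diff: "is_ideal J \<Longrightarrow> a \<in> J \<Longrightarrow> b \<in> J \<Longrightarrow> a - b \<in> J"
  and is_ideal_minus: "is_ideal J \<Longrightarrow> a \<in> J \<Longrightarrow> - a \<in> J"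
  and is_ideal_mult: "is_ideal J \<Longrightarrow> a \<in> J \<Longrightarrow> c * a \<in> J"
  and is_ideal_mult_right: "is_ideal J \<Longrightarrow> a \<in> J \<Longrightarrow> a * c \<in> J"
  and is_ideal_sum: "is_ideal J \<Longrightarrow> (\<And>i. i \<in> A \<Longrightarrow> f i \<in> J) \<Longrightarrow> sum f A \<in> J"
  for J :: "'a::comm_ring_1 set"
  unfolding is_ideal_def
  by (auto intro: Modules.module.subspace_0[OF module_times] Modules.module.subspace_add[OF module_times]
      Modules.module.subspace_diff[OF module_times] Modules.module.subspace_neg[OF module_times]
      Modules.module.subspace_scale[OF module_times] Modules.module.subspace_sum[OF module_times]
      simp: mult.commute[of _ c])

lemma is_idealI:
  "0 \<in> J \<Longrightarrow> (\<And>a b. a \<in> J \<Longrightarrow> b \<in> J \<Longrightarrow> a + b \<in> J) \<Longrightarrow> (\<And>c a. a \<in> J \<Longrightarrow> c * a \<in> J) \<Longrightarrow> is_ideal J"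
  for J :: "'a::comm_ring_1 set"
  unfolding is_ideal_def by (auto intro: Modules.module.subspaceI[OF module_times])

lemma is_ideal_span [simp]: "is_ideal (ideal_span X)"
  unfolding is_ideal_def ideal_span_def by (rule Modules.module.subspace_span[OF module_times])

lemma ideal_span_base: "a \<in> X \<Longrightarrow> a \<in> ideal_span X"
  unfolding ideal_span_def by (rule Modules.module.span_base[OF module_times])

lemma ideal_span_minimal: "is_ideal J \<Longrightarrow> X \<subseteq> J \<Longrightarrow> ideal_span X \<subseteq> J"
  unfolding is_ideal_def ideal_span_def by (rule Modules.module.span_minimal[OF module_times])

lemma ideal_span_insert: "a \<in> ideal_span (insert x X) \<longleftrightarrow> (\<exists>b. a - b * x \<in> ideal_span X)"
  unfolding ideal_span_def by (simp add: Modules.module.span_insert[OF module_times])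

lemma ideal_span_empty [simp]: "ideal_span {} = {0}"
  unfolding ideal_span_def by (rule Modules.module.span_empty[OF module_times])

lemma ideal_span_mono: "X \<subseteq> Y \<Longrightarrow> ideal_span X \<subseteq> ideal_span Y"
  unfolding ideal_span_def by (rule Modules.module.span_mono[OF module_times])

section \<open>Exterior powers with polynomial coefficients\<close>

text \<open>
  An element \<open>g\<close> of this type is a family of elements of the exterior algebra of \<open>A\<^sup>n\<close>, indexed by exponents
  \<open>\<alpha>\<close>: \<open>g \<alpha> K\<close> is the coefficient at the basis element \<open>e\<^bsub>k\<^sub>1\<^esub> \<and> e\<^bsub>k\<^sub>2\<^esub> \<and> \<dots>\<close> with \<open>K = {k\<^sub>1 < k\<^sub>2 < \<dots>}\<close> and at the
  divided power with exponent \<open>\<alpha>\<close>. All terms of the Buchsbaum-Rim complex are thus functions of one type, cut out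
  by conditions on their support, and a reduction modulo an ideal is a condition on the values.
\<close>

type_synonym 'a ext = "(nat \<Rightarrow> nat) \<Rightarrow> nat set \<Rightarrow> 'a"

definition cscale :: "'a::comm_ring_1 \<Rightarrow> 'a ext \<Rightarrow> 'a ext" where
  "cscale a g = (\<lambda>\<alpha> K. a * g \<alpha> K)"

lemma module_cscale: "Modules.module (cscale :: 'a::comm_ring_1 \<Rightarrow> 'a ext \<Rightarrow> 'a ext)"
  by (rule Modules.module.intro) (simp_all add: cscale_def plus_fun_def distrib_left distrib_right mult.assoc)

interpretation ext: Modules.module "cscale :: 'a::comm_ring_1 \<Rightarrow> 'a ext \<Rightarrow> 'a ext"
  by (rule module_cscale)

definition valued :: "'a::comm_ring_1 set \<Rightarrow> 'a ext \<Rightarrow> bool" where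
  "valued J g \<longleftrightarrow> (\<forall>\<alpha> K. g \<alpha> K \<in> J)"

text \<open>
  The third clause says that the map acts modulo every ideal. For the maps below it holds because each value
  is a finite linear combination of values of the argument.
\<close>

definition ideal_linear :: "('a::comm_ring_1 ext \<Rightarrow> 'a ext) \<Rightarrow> bool" where
  "ideal_linear f \<longleftrightarrow> (\<forall>g h. f (g + h) = f g + f h) \<and> (\<forall>a g. f (cscale a g) = cscale a (f g)) \<and>
     (\<forall>J g. is_ideal J \<longrightarrow> valued J g \<longrightarrow> valued J (f g))"

lemma sum_ext_apply: "(\<Sum>i\<in>A. f i) \<alpha> K = (\<Sum>i\<in>A. f i \<alpha> K)" for f :: "'i \<Rightarrow> 'a::comm_ring_1 ext"
  by (induction A rule: infinite_finite_induct) auto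

lemma
  assumes "is_ideal J"
  shows valued_0: "valued J 0"
    and valued_add: "valued J g \<Longrightarrow> valued J h \<Longrightarrow> valued J (g + h)"
    and valued_diff: "valued J g \<Longrightarrow> valued J h \<Longrightarrow> valued J (g - h)"
    and valued_cscale: "valued J g \<Longrightarrow> valued J (cscale a g)"
    and valued_sum: "(\<And>i. i \<in> A \<Longrightarrow> valued J (f i)) \<Longrightarrow> valued J (sum f A)"
  using assms unfolding valued_def cscale_def
  by (auto simp: sum_ext_apply intro: is_ideal_zero is_ideal_add is_ideal_diff is_ideal_minus is_ideal_mult is_ideal_sum)

lemma ideal_linear_add: "ideal_linear f \<Longrightarrow> f (g + h) = f g + f h"
  and ideal_linear_cscale: "ideal_linear f \<Longrightarrow> f (cscale a g) = cscale a (f g)"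
  and ideal_linear_valued: "ideal_linear f \<Longrightarrow> is_ideal J \<Longrightarrow> valued J g \<Longrightarrow> valued J (f g)"
  by (auto simp: ideal_linear_def)

lemma ideal_linear_0:
  assumes "ideal_linear f"
  shows "f 0 = 0"
proof -
  have "f 0 = f 0 + f 0"
    using ideal_linear_add[OF assms, of 0 0] by (simp only: add_0)
  then show ?thesis by (simp only: add_cancel_right_right)
qed

lemma ideal_linear_minus:
  assumes "ideal_linear f"
  shows "f (- g) = - f g"
proof -
  have "f g + f (- g) = 0"
    using ideal_linear_add[OF assms, of g "- g"] ideal_linear_0[OF assms] by (simp only: add.right_inverse)
  then show ?thesis by (simp only: eq_neg_iff_add_eq_0 add.commute)
qed

lemma ideal_linear_diff:
  assumes "ideal_linear f"
  shows "f (g - h) = f g - f h"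
  unfolding diff_conv_add_uminus ideal_linear_add[OF assms] ideal_linear_minus[OF assms] ..

lemma ideal_linear_sum:
  assumes "ideal_linear f"
  shows "f (\<Sum>i\<in>A. g i) = (\<Sum>i\<in>A. f (g i))"
proof (induction A rule: infinite_finite_induct)
  case (infinite A)
  then show ?case by (simp only: sum.infinite not_False_eq_True ideal_linear_0[OF assms])
next
  case empty
  show ?case by (simp only: sum.empty ideal_linear_0[OF assms])
next
  case (insert x F)
  then show ?case
    by (simp only: sum.insert ideal_linear_add[OF assms] not_False_eq_True)
qed

lemmas ideal_linear_rules = ideal_linear_0 ideal_linear_add ideal_linear_minus ideal_linear_diff
  ideal_linear_sum ideal_linear_cscale

lemma ideal_linear_sum_cscale:
  assumes "\<And>i. i \<in> A \<Longrightarrow> ideal_linear (f i)"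
  shows "ideal_linear (\<lambda>g. \<Sum>i\<in>A. cscale (a i) (f i g))"
  unfolding ideal_linear_def
proof (intro conjI allI impI)
  show "(\<Sum>i\<in>A. cscale (a i) (f i (g + h))) = (\<Sum>i\<in>A. cscale (a i) (f i g)) + (\<Sum>i\<in>A. cscale (a i) (f i h))" for g h
    unfolding sum.distrib[symmetric]
    by (rule sum.cong[OF refl]) (simp only: ideal_linear_add[OF assms] ext.scale_right_distrib)
  show "(\<Sum>i\<in>A. cscale (a i) (f i (cscale b g))) = cscale b (\<Sum>i\<in>A. cscale (a i) (f i g))" for b g
    unfolding ext.scale_sum_right
    by (rule sum.cong[OF refl]) (simp only: ideal_linear_cscale[OF assms] ext.scale_scale mult.commute)
  show "valued J (\<Sum>i\<in>A. cscale (a i) (f i g))" if "is_ideal J" "valued J g" for J g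
    using that assms by (intro valued_sum valued_cscale) (auto simp: ideal_linear_valued)
qed

lemma ideal_linear_compose: "ideal_linear f \<Longrightarrow> ideal_linear h \<Longrightarrow> ideal_linear (\<lambda>g. f (h g))"
  by (simp add: ideal_linear_def)

lemma ideal_linear_sum_ops:
  assumes "\<And>i. i \<in> A \<Longrightarrow> ideal_linear (f i)"
  shows "ideal_linear (\<lambda>g. \<Sum>i\<in>A. f i g)"
  using ideal_linear_sum_cscale[of A f "\<lambda>_. 1"] assms by simp

text \<open>
  The sign that \<open>e\<^sub>j\<close> picks up when it moves past the smaller elements of \<open>K\<close>. With it the operators \<open>ann\<close>
  (contraction with the \<open>j\<close>-th dual basis vector) and \<open>cre\<close> (left multiplication by \<open>e\<^sub>j\<close>) are the
  annihilation and creation operators, and they satisfy the canonical anticommutation relations.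
\<close>

definition alt_sign :: "nat \<Rightarrow> nat set \<Rightarrow> 'a::comm_ring_1" where
  "alt_sign j K = (- 1) ^ card {i \<in> K. i < j}"

lemma alt_sign_insert:
  assumes "j \<notin> K"
  shows "alt_sign i (insert j K) = (if j < i then - alt_sign i K else alt_sign i K)"
proof -
  have "{k \<in> insert j K. k < i} = (if j < i then insert j {k \<in> K. k < i} else {k \<in> K. k < i})"
    by auto
  moreover have "finite {k \<in> K. k < i}" by simp
  ultimately show ?thesis using assms by (simp add: alt_sign_def)
qed

lemma alt_sign_remove:
  assumes "j \<in> K"
  shows "alt_sign i (K - {j}) = (if j < i then - alt_sign i K else alt_sign i K :: 'a::comm_ring_1)"
proof -
  have "alt_sign i (insert j (K - {j})) = (if j < i then - alt_sign i (K - {j}) else alt_sign i (K - {j}) :: 'a)"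
    by (rule alt_sign_insert) simp
  then show ?thesis using assms by (auto simp: insert_absorb split: if_splits)
qed

lemma alt_sign_square [simp]: "alt_sign j K * alt_sign j K = 1"
  by (simp add: alt_sign_def flip: power_mult_distrib)

lemma alt_sign_square_left [simp]: "alt_sign j K * (alt_sign j K * a) = a"
  by (simp flip: mult.assoc)

definition ann :: "nat \<Rightarrow> 'a::comm_ring_1 ext \<Rightarrow> 'a ext" where
  "ann j g = (\<lambda>\<alpha> K. if j \<in> K then 0 else alt_sign j K * g \<alpha> (insert j K))"

definition cre :: "nat \<Rightarrow> 'a::comm_ring_1 ext \<Rightarrow> 'a ext" where
  "cre j g = (\<lambda>\<alpha> K. if j \<in> K then alt_sign j K * g \<alpha> (K - {j}) else 0)"

text \<open>
  On divided powers, \<open>shift k\<close> is multiplication by the variable \<open>t\<^sub>k\<close>, that is contraction of the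
  divided powers. The map \<open>raise k\<close> is a section of it, and \<open>at_zero k\<close> projects onto the part that \<open>shift k\<close> kills.
\<close>

definition shift :: "nat \<Rightarrow> 'a::comm_ring_1 ext \<Rightarrow> 'a ext" where
  "shift k g = (\<lambda>\<alpha>. g (\<alpha>(k := Suc (\<alpha> k))))"

definition raise :: "nat \<Rightarrow> 'a::comm_ring_1 ext \<Rightarrow> 'a ext" where
  "raise k g = (\<lambda>\<alpha> K. if \<alpha> k = 0 then 0 else g (\<alpha>(k := \<alpha> k - 1)) K)"

definition at_zero :: "nat \<Rightarrow> 'a::comm_ring_1 ext \<Rightarrow> 'a ext" where
  "at_zero k g = (\<lambda>\<alpha> K. if \<alpha> k = 0 then g \<alpha> K else 0)"

lemma ideal_linear_basic [simp]:
  "ideal_linear (ann j)" "ideal_linear (cre j)"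
  "ideal_linear (shift k)" "ideal_linear (raise k)" "ideal_linear (at_zero k)"
  by (auto simp: ideal_linear_def ann_def cre_def shift_def raise_def at_zero_def cscale_def valued_def
      fun_eq_iff algebra_simps is_ideal_zero is_ideal_mult)

lemmas ann_linear = ideal_linear_rules[OF ideal_linear_basic(1)]
lemmas cre_linear = ideal_linear_rules[OF ideal_linear_basic(2)]
lemmas shift_linear = ideal_linear_rules[OF ideal_linear_basic(3)]
lemmas at_zero_linear = ideal_linear_rules[OF ideal_linear_basic(5)]
lemmas raise_linear = ideal_linear_rules[OF ideal_linear_basic(4)]

lemma ann_ann: "ann i (ann j g) = - ann j (ann i g)"
  by (auto simp: ann_def fun_eq_iff alt_sign_insert insert_commute mult_ac)

lemma ann_ann_same: "ann i (ann i g) = 0"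
  by (auto simp: ann_def fun_eq_iff)

lemma ann_cre: "ann i (cre j g) = (if i = j then g else 0) - cre j (ann i g)"
proof (cases "i = j")
  case True
  then show ?thesis
    by (auto simp: ann_def cre_def fun_eq_iff alt_sign_insert alt_sign_remove insert_absorb)
next
  case False
  then have "insert i K - {j} = insert i (K - {j})" for K by auto
  with False show ?thesis
    by (auto simp: ann_def cre_def fun_eq_iff alt_sign_insert alt_sign_remove mult_ac)
qed

lemma ann_shift: "ann j (shift k g) = shift k (ann j g)"
  by (auto simp: ann_def shift_def fun_eq_iff)

lemma cre_shift: "cre j (shift k g) = shift k (cre j g)"
  by (auto simp: cre_def shift_def fun_eq_iff)

lemma ann_raise: "ann j (raise k g) = raise k (ann j g)"
  by (auto simp: ann_def raise_def fun_eq_iff)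

lemma ann_at_zero: "ann j (at_zero k g) = at_zero k (ann j g)"
  by (auto simp: ann_def at_zero_def fun_eq_iff)

lemma cre_at_zero: "cre j (at_zero k g) = at_zero k (cre j g)"
  by (auto simp: cre_def at_zero_def fun_eq_iff)

lemma shift_shift: "shift k (shift l g) = shift l (shift k g)"
  by (cases "k = l") (auto simp: shift_def fun_eq_iff fun_upd_twist)

lemma shift_raise_same: "shift k (raise k g) = g"
  by (auto simp: shift_def raise_def fun_eq_iff)

lemma raise_shift_same: "raise k (shift k g) = g - at_zero k g"
  by (auto simp: shift_def raise_def at_zero_def fun_eq_iff)

lemma shift_raise: "l \<noteq> k \<Longrightarrow> shift l (raise k g) = raise k (shift l g)"
  by (auto simp: shift_def raise_def fun_eq_iff fun_upd_twist)

definition contr :: "nat \<Rightarrow> (nat \<Rightarrow> 'a) \<Rightarrow> 'a::comm_ring_1 ext \<Rightarrow> 'a ext" where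
  "contr n f g = (\<Sum>j<n. cscale (f j) (ann j g))"

definition wedge :: "nat \<Rightarrow> (nat \<Rightarrow> 'a) \<Rightarrow> 'a::comm_ring_1 ext \<Rightarrow> 'a ext" where
  "wedge n v g = (\<Sum>j<n. cscale (v j) (cre j g))"

lemma ideal_linear_contr [simp]: "ideal_linear (contr n f)"
  unfolding contr_def[abs_def] by (rule ideal_linear_sum_cscale) simp

lemma ideal_linear_wedge [simp]: "ideal_linear (wedge n v)"
  unfolding wedge_def[abs_def] by (rule ideal_linear_sum_cscale) simp

lemmas contr_linear = ideal_linear_rules[OF ideal_linear_contr]
lemmas wedge_linear = ideal_linear_rules[OF ideal_linear_wedge]

lemma contr_ann: "contr n f (ann i g) = - ann i (contr n f g)"
  unfolding contr_def by (simp add: ann_linear cre_linear contr_linear wedge_linear shift_linear raise_linear ann_ann[of _ i] sum_negf)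

lemma contr_contr: "contr n f (contr m h g) = - contr m h (contr n f g)"
proof -
  have "contr n f (contr m h g) = (\<Sum>j<m. cscale (h j) (contr n f (ann j g)))"
    unfolding contr_def[of m] by (simp add: ann_linear cre_linear contr_linear wedge_linear shift_linear raise_linear)
  then show ?thesis
    by (simp add: contr_ann sum_negf contr_def[of m])
qed

text \<open>
  In characteristic 2 the vanishing does not follow from anticommutation. The induction on \<open>n\<close> adds one
  summand at a time, with \<open>ann_ann_same\<close> for the square of the new summand.
\<close>

lemma contr_contr_same: "contr n f (contr n f g) = 0"
proof (induction n)
  case 0
  show ?case by (simp add: contr_def)
next
  case (Suc n)
  have step: "contr (Suc n) f g = contr n f g + cscale (f n) (ann n g)" for g
    by (simp add: contr_def)
  show ?case
    unfolding step by (simp add: ann_linear cre_linear contr_linear wedge_linear shift_linear raise_linear Suc contr_ann ann_ann_same)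
qed

text \<open>
  The contraction is an antiderivation; the scalar is the pairing of the linear form with the vector.
\<close>

lemma contr_wedge: "contr n f (wedge n v g) = cscale (\<Sum>j<n. f j * v j) g - wedge n v (contr n f g)"
proof -
  have "contr n f (wedge n v g) = (\<Sum>i<n. \<Sum>j<n. cscale (f i) (cscale (v j) (if i = j then g else 0)))
      - (\<Sum>i<n. \<Sum>j<n. cscale (f i) (cscale (v j) (cre j (ann i g))))"
    unfolding contr_def wedge_def
    by (simp add: ann_linear cre_linear contr_linear wedge_linear shift_linear raise_linear ann_cre ext.scale_sum_right ext.scale_right_diff_distrib
        flip: sum_subtractf)
  also have "(\<Sum>i<n. \<Sum>j<n. cscale (f i) (cscale (v j) (if i = j then g else 0))) = cscale (\<Sum>j<n. f j * v j) g"
    by (simp add: ext.scale_sum_left if_distrib cong: if_cong)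
  also have "(\<Sum>i<n. \<Sum>j<n. cscale (f i) (cscale (v j) (cre j (ann i g)))) = wedge n v (contr n f g)"
    unfolding contr_def wedge_def
    by (subst sum.swap) (simp add: ann_linear cre_linear contr_linear wedge_linear shift_linear raise_linear ext.scale_sum_right mult.commute)
  finally show ?thesis .
qed

lemma contr_shift: "contr n f (shift k g) = shift k (contr n f g)"
  unfolding contr_def by (simp add: ann_linear cre_linear contr_linear wedge_linear shift_linear raise_linear ann_shift)

lemma contr_at_zero: "contr n f (at_zero k g) = at_zero k (contr n f g)"
  unfolding contr_def by (simp add: at_zero_linear ann_at_zero)

lemma wedge_at_zero: "wedge n v (at_zero k g) = at_zero k (wedge n v g)"
  unfolding wedge_def by (simp add: at_zero_linear cre_at_zero)

lemma wedge_shift: "wedge n v (shift k g) = shift k (wedge n v g)"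
  unfolding wedge_def by (simp add: ann_linear cre_linear contr_linear wedge_linear shift_linear raise_linear cre_shift)

lemma contr_raise: "contr n f (raise k g) = raise k (contr n f g)"
  unfolding contr_def by (simp add: ann_linear cre_linear contr_linear wedge_linear shift_linear raise_linear ann_raise)

section \<open>The Buchsbaum-Rim complex\<close>

definition supported :: "((nat \<Rightarrow> nat) \<times> nat set) set \<Rightarrow> 'a::comm_ring_1 ext \<Rightarrow> bool" where
  "supported S g \<longleftrightarrow> (\<forall>\<alpha> K. (\<alpha>, K) \<notin> S \<longrightarrow> g \<alpha> K = 0)"

lemma supported_0 [simp]: "supported S 0"
  and supported_add: "supported S g \<Longrightarrow> supported S h \<Longrightarrow> supported S (g + h)"
  and supported_cscale: "supported S g \<Longrightarrow> supported S (cscale a g)"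
  by (auto simp: supported_def cscale_def)

lemma supported_sum: "(\<And>i. i \<in> A \<Longrightarrow> supported S (f i)) \<Longrightarrow> supported S (sum f A)"
  by (auto simp: supported_def sum_ext_apply)

text \<open>
  The inductive step of the acyclicity lemma. If \<open>x v\<close> is a boundary \<open>D u\<close> modulo \<open>J\<close>, then \<open>u\<close> is a cycle modulo
  \<open>J' = J + (x)\<close>, so by exactness there \<open>u = z + x w\<close> modulo \<open>J\<close> with a cycle \<open>z\<close>. Then \<open>x (v - D w)\<close> vanishes modulo
  \<open>J\<close>, and \<open>x\<close> can be cancelled.
\<close>

lemma boundary_cancel:
  assumes J: "is_ideal J" and J': "is_ideal J'" "J \<subseteq> J'" "x \<in> J'"
    and J'_imp: "\<And>a. a \<in> J' \<Longrightarrow> \<exists>b. a - x * b \<in> J"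
    and nzd: "\<And>a. x * a \<in> J \<Longrightarrow> a \<in> J"
    and D: "ideal_linear D"
    and exact: "\<And>u. supported S u \<Longrightarrow> valued J' (D u) \<Longrightarrow>
      \<exists>z. supported S z \<and> D z = 0 \<and> valued J' (u - z)"
    and u: "supported S u" "valued J (cscale x v - D u)"
  shows "\<exists>u. supported S u \<and> valued J (v - D u)"
proof -
  have "valued J' (D u)"
  proof -
    have "D u \<alpha> K \<in> J'" for \<alpha> K
    proof -
      have "x * v \<alpha> K - D u \<alpha> K \<in> J'"
        using u(2) J'(2) by (auto simp: valued_def cscale_def)
      with is_ideal_mult_right[OF J'(1,3)] have "x * v \<alpha> K - (x * v \<alpha> K - D u \<alpha> K) \<in> J'"
        by (rule is_ideal_diff[OF J'(1)])
      then show ?thesis by (simp only: diff_diff_eq2 add_diff_cancel_left')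
    qed
    then show ?thesis unfolding valued_def by blast
  qed
  from exact[OF u(1) this] obtain z where z: "supported S z" "D z = 0" "valued J' (u - z)"
    by blast
  define b where "b \<alpha> K = (SOME b. (u - z) \<alpha> K - x * b \<in> J)" for \<alpha> K
  have b: "(u - z) \<alpha> K - x * b \<alpha> K \<in> J" for \<alpha> K
    unfolding b_def using z(3) by (intro someI_ex[OF J'_imp]) (simp only: valued_def)
  \<comment> \<open>the quotient is set to 0 where nothing is to be divided, so that it keeps the support\<close>
  define w where "w = (\<lambda>\<alpha> K. if (u - z) \<alpha> K = 0 then 0 else b \<alpha> K)"
  have w: "supported S w"
    using u(1) z(1) by (auto simp: w_def supported_def)
  have "valued J (u - z - cscale x w)"
    using b by (auto simp: valued_def w_def cscale_def is_ideal_zero[OF J])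
  then have "valued J (D (u - z - cscale x w))"
    by (rule ideal_linear_valued[OF D J])
  also have "D (u - z - cscale x w) = D u - cscale x (D w)"
    by (simp only: ideal_linear_rules[OF D] z(2) diff_0_right)
  finally have "valued J (cscale x v - D u + (D u - cscale x (D w)))"
    by (intro valued_add J u(2))
  then have "x * (v - D w) \<alpha> K \<in> J" for \<alpha> K
    by (simp add: valued_def cscale_def right_diff_distrib)
  then have "valued J (v - D w)"
    using nzd by (simp add: valued_def)
  with w show ?thesis by blast
qed

lemma boundary_cancel_power:
  assumes J: "is_ideal J" and J': "is_ideal J'" "J \<subseteq> J'" "x \<in> J'"
    and J'_imp: "\<And>a. a \<in> J' \<Longrightarrow> \<exists>b. a - x * b \<in> J"
    and nzd: "\<And>a. x * a \<in> J \<Longrightarrow> a \<in> J"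
    and D: "ideal_linear D"
    and exact: "\<And>u. supported S u \<Longrightarrow> valued J' (D u) \<Longrightarrow>
      \<exists>z. supported S z \<and> D z = 0 \<and> valued J' (u - z)"
    and u: "\<exists>u. supported S u \<and> valued J (cscale (x ^ m) v - D u)"
  shows "\<exists>u. supported S u \<and> valued J (v - D u)"
  using u
proof (induction m)
  case (Suc m)
  then obtain u where "supported S u" "valued J (cscale x (cscale (x ^ m) v) - D u)"
    unfolding power_Suc ext.scale_scale by blast
  from Suc.IH[OF boundary_cancel[OF J J' J'_imp nzd D exact this]] show ?case .
qed (simp only: power_0 ext.scale_one)

text \<open>
  The matrix has rows \<open>C 0, \<dots>, C (r - 1)\<close> and \<open>n\<close> columns. The Buchsbaum-Rim complex consists of the maps
  \<open>(bd k)\<^bsub>k<r\<^esub>\<close> from degree 1 of the exterior algebra to \<open>A\<^sup>r\<close>, \<open>bds r\<close> from degree \<open>r + 1\<close> to degree 1,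
  and \<open>tail\<close> further to the left, where divided powers of degree \<open>q\<close> are paired with exterior degree \<open>r + 1 + q\<close>.
\<close>

locale column_matrix =
  fixes C :: "nat \<Rightarrow> nat \<Rightarrow> 'a::comm_ring_1" and r n :: nat
begin

abbreviation bd :: "nat \<Rightarrow> 'a ext \<Rightarrow> 'a ext" where
  "bd k \<equiv> contr n (C k)"

fun bds :: "nat \<Rightarrow> 'a ext \<Rightarrow> 'a ext" where
  "bds 0 g = g"
| "bds (Suc m) g = bds m (bd m g)"

definition tail :: "'a ext \<Rightarrow> 'a ext" where
  "tail g = (\<Sum>k<r. bd k (shift k g))"

definition exponent :: "nat \<Rightarrow> (nat \<Rightarrow> nat) \<Rightarrow> bool" where
  "exponent q \<alpha> \<longleftrightarrow> (\<forall>k\<ge>r. \<alpha> k = 0) \<and> (\<Sum>k<r. \<alpha> k) = q"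

definition cells :: "nat \<Rightarrow> nat \<Rightarrow> ((nat \<Rightarrow> nat) \<times> nat set) set" where
  "cells q d = {(\<alpha>, K). exponent q \<alpha> \<and> K \<subseteq> {..<n} \<and> card K = d}"

lemma ideal_linear_bds [simp]: "ideal_linear (bds m)"
proof (induction m)
  case 0
  have "bds 0 = (\<lambda>g. g)"
    by (rule HOL.ext) (rule bds.simps(1))
  then show ?case by (simp only: ideal_linear_def simp_thms)
next
  case (Suc m)
  have "bds (Suc m) = (\<lambda>g. bds m (bd m g))"
    by (rule HOL.ext) (rule bds.simps(2))
  with ideal_linear_compose[OF Suc ideal_linear_contr] show ?case
    by (simp only:)
qed

lemma ideal_linear_tail [simp]: "ideal_linear tail"
proof -
  have "tail = (\<lambda>g. \<Sum>k<r. bd k (shift k g))"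
    by (rule HOL.ext) (rule tail_def)
  moreover have "ideal_linear (\<lambda>g. bd k (shift k g))" for k
    by (rule ideal_linear_compose[OF ideal_linear_contr ideal_linear_basic(3)])
  ultimately show ?thesis
    by (simp only: ideal_linear_sum_ops)
qed

lemmas bds_linear = ideal_linear_rules[OF ideal_linear_bds]
lemmas tail_linear = ideal_linear_rules[OF ideal_linear_tail]

lemma bd_bds: "bd l (bds m g) = cscale ((- 1) ^ m) (bds m (bd l g))"
  by (induction m arbitrary: g) (simp_all add: contr_contr[of n "C l"] bds_linear)

lemma ann_bds: "ann i (bds m g) = cscale ((- 1) ^ m) (bds m (ann i g))"
  by (induction m arbitrary: g) (simp_all add: contr_ann bds_linear)

lemma bds_bd: "k < m \<Longrightarrow> bds m (bd k g) = 0"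
  by (induction m arbitrary: g)
    (auto simp: less_Suc_eq contr_contr_same bds_linear contr_contr[of n "C m" n "C k" for m])

lemma bd_bds_0: "k < m \<Longrightarrow> bd k (bds m g) = 0"
  by (simp add: bd_bds bds_bd)

lemma bds_wedge:
  assumes "\<And>k. k < m \<Longrightarrow> (\<Sum>j<n. C k j * v j) = 0"
  shows "bds m (wedge n v g) = cscale ((- 1) ^ m) (wedge n v (bds m g))"
  using assms
  by (induction m arbitrary: g) (simp_all add: contr_wedge bds_linear wedge_linear)

lemma bds_at_zero: "bds m (at_zero k g) = at_zero k (bds m g)"
  by (induction m arbitrary: g) (simp_all add: contr_at_zero)

lemma bds_tail: "bds r (tail g) = 0"
  unfolding tail_def by (simp add: bds_linear bds_bd)

lemma bd_shift_bd_shift: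
  "bd k (shift k (bd l (shift l g))) = - bd l (shift l (bd k (shift k g)))"
  by (simp only: contr_shift[of _ _ l] contr_shift[of _ _ k] contr_contr[of n "C k" n "C l"] shift_linear
      shift_shift[of k l])

text \<open>
  The summands of \<open>tail\<close> square to zero and anticommute; adding them one by one avoids a division by 2.
\<close>

lemma tail_tail: "tail (tail g) = 0"
proof -
  define T where "T m g = (\<Sum>k<m. bd k (shift k g))" for m g
  have lin: "ideal_linear (T m)" for m
    unfolding T_def[abs_def]
    by (rule ideal_linear_sum_ops, rule ideal_linear_compose[OF ideal_linear_contr ideal_linear_basic(3)])
  have anti: "T m (bd k (shift k g)) = - bd k (shift k (T m g))" for m k g
    unfolding T_def shift_linear contr_linear bd_shift_bd_shift[of _ k] sum_negf ..
  have "T m (T m g) = 0" for m g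
  proof (induction m)
    case 0
    show ?case by (simp only: T_def lessThan_0 sum.empty)
  next
    case (Suc m)
    have step: "T (Suc m) h = T m h + bd m (shift m h)" for h
      by (simp only: T_def sum.lessThan_Suc)
    have "bd m (shift m (bd m (shift m g))) = 0"
      by (simp only: contr_shift contr_contr_same shift_linear)
    then show ?case
      unfolding step ideal_linear_add[OF lin] Suc anti shift_linear contr_linear
      by (simp only: add_0_left add_0_right add.right_inverse)
  qed
  then show ?thesis
    unfolding T_def tail_def by blast
qed

lemma cells_insert:
  assumes "j \<notin> K" "(\<alpha>, insert j K) \<in> cells q (Suc d)"
  shows "(\<alpha>, K) \<in> cells q d"
proof -
  have "insert j K \<subseteq> {..<n}" "card (insert j K) = Suc d" "exponent q \<alpha>"
    using assms(2) by (simp_all only: cells_def mem_Collect_eq case_prod_conv)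
  moreover from this(1) have "finite K"
    by (meson finite_lessThan finite_subset subset_insertI)
  ultimately show ?thesis
    using assms(1) by (simp only: cells_def mem_Collect_eq case_prod_conv card_insert_disjoint) simp
qed

lemma cells_remove:
  assumes "j \<in> K" "j < n" "(\<alpha>, K - {j}) \<in> cells q d"
  shows "(\<alpha>, K) \<in> cells q (Suc d)"
proof -
  have "K - {j} \<subseteq> {..<n}" "card (K - {j}) = d" "exponent q \<alpha>"
    using assms(3) by (simp_all only: cells_def mem_Collect_eq case_prod_conv)
  moreover from this(1) assms(2) have "K \<subseteq> {..<n}" by auto
  moreover from this have "finite K"
    by (meson finite_lessThan finite_subset)
  ultimately show ?thesis
    using assms(1) by (simp only: cells_def mem_Collect_eq case_prod_conv card.remove[of K j])
qed

lemma supported_bd: "supported (cells q (Suc d)) g \<Longrightarrow> supported (cells q d) (bd k g)"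
proof -
  assume g: "supported (cells q (Suc d)) g"
  have "supported (cells q d) (ann j g)" for j
    unfolding supported_def ann_def using g cells_insert[of j _ _ q d]
    by (metis (no_types, lifting) mult_zero_right supported_def)
  then show ?thesis
    unfolding contr_def by (intro supported_sum supported_cscale)
qed

lemma supported_wedge: "supported (cells q d) g \<Longrightarrow> supported (cells q (Suc d)) (wedge n v g)"
proof -
  assume g: "supported (cells q d) g"
  have "supported (cells q (Suc d)) (cre j g)" if "j < n" for j
    unfolding supported_def cre_def using g cells_remove[of j _ _ q d] that
    by (metis (no_types, lifting) mult_zero_right supported_def)
  then show ?thesis
    unfolding wedge_def by (intro supported_sum supported_cscale) auto
qed

lemma exponent_Suc:
  assumes "k < r"
  shows "exponent (Suc q) (\<alpha>(k := Suc (\<alpha> k))) \<longleftrightarrow> exponent q \<alpha>"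
proof -
  have "(\<Sum>l<r. (\<alpha>(k := Suc (\<alpha> k))) l) = Suc (\<Sum>l<r. \<alpha> l)"
    using assms by (simp add: sum.remove[of _ k])
  moreover have "(\<forall>l\<ge>r. (\<alpha>(k := Suc (\<alpha> k))) l = 0) \<longleftrightarrow> (\<forall>l\<ge>r. \<alpha> l = 0)"
    using assms by auto
  ultimately show ?thesis by (simp only: exponent_def nat.inject)
qed

lemma supported_shift:
  assumes "k < r" "supported (cells (Suc q) d) g"
  shows "supported (cells q d) (shift k g)"
  using assms(2) exponent_Suc[OF assms(1), of q]
  by (simp only: supported_def shift_def cells_def mem_Collect_eq case_prod_conv) metis

lemma supported_raise:
  assumes "k < r" "supported (cells q d) g"
  shows "supported (cells (Suc q) d) (raise k g)"
  unfolding supported_def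
proof (intro allI impI)
  fix \<alpha> K assume *: "(\<alpha>, K) \<notin> cells (Suc q) d"
  show "raise k g \<alpha> K = 0"
  proof (cases "\<alpha> k")
    case (Suc a)
    define \<beta> where "\<beta> = \<alpha>(k := a)"
    have \<alpha>: "\<alpha> = \<beta>(k := Suc (\<beta> k))"
      using Suc by (auto simp: \<beta>_def)
    have "exponent (Suc q) \<alpha> \<longleftrightarrow> exponent q \<beta>"
      unfolding \<alpha> by (rule exponent_Suc[OF assms(1)])
    with * have "(\<beta>, K) \<notin> cells q d"
      unfolding cells_def by blast
    with assms(2) have "g \<beta> K = 0"
      unfolding supported_def by blast
    with Suc show ?thesis by (simp add: raise_def \<beta>_def)
  qed (simp add: raise_def)
qed

lemma supported_at_zero: "supported S g \<Longrightarrow> supported S (at_zero k g)"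
  by (auto simp: supported_def at_zero_def)

lemma supported_tail: "supported (cells (Suc q) (Suc d)) g \<Longrightarrow> supported (cells q d) (tail g)"
  unfolding tail_def by (intro supported_sum supported_bd supported_shift) auto

text \<open>
  An element \<open>x\<close> with \<open>x t\<^sub>k \<in> N\<close> acts on the tail, up to homotopy, as a map into the part with exponent 0 at
  \<open>k\<close>: the homotopy raises the exponent at \<open>k\<close> and multiplies by the vector \<open>v\<close> that expresses \<open>x t\<^sub>k\<close> in the
  columns. Since \<open>v\<close> pairs to zero with the other rows, only the \<open>k\<close>-th summand of \<open>tail\<close> contributes.
\<close>

lemma homotopy:
  assumes k: "k < r" and v: "\<And>l. l < r \<Longrightarrow> (\<Sum>j<n. C l j * v j) = (if l = k then x else 0)"
  shows "cscale x g = tail (wedge n v (raise k g)) + wedge n v (raise k (tail g)) + at_zero k (wedge n v (bd k g))"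
proof -
  have summand: "bd l (shift l (wedge n v (raise k g))) + wedge n v (raise k (bd l (shift l g)))
     = (if l = k then cscale x g - at_zero k (wedge n v (bd k g)) else 0)" if "l < r" for l
  proof (cases "l = k")
    case True
    have "bd k (shift k (wedge n v (raise k g))) = cscale x g - wedge n v (bd k g)"
      using v[OF k] by (simp only: wedge_shift[symmetric] shift_raise_same contr_wedge if_True simp_thms)
    moreover have "wedge n v (raise k (bd k (shift k g))) = wedge n v (bd k g) - at_zero k (wedge n v (bd k g))"
      by (simp only: contr_shift raise_shift_same wedge_linear wedge_at_zero)
    ultimately show ?thesis
      using True by (simp only: if_True simp_thms) (simp only: algebra_simps)
  next
    case False
    with v[OF that] show ?thesis
      by (simp only: wedge_shift[symmetric] shift_raise[OF False] contr_wedge contr_raise if_False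
          ext.scale_zero_left diff_0 add.left_inverse)
  qed
  have "tail (wedge n v (raise k g)) + wedge n v (raise k (tail g)) =
    (\<Sum>l<r. bd l (shift l (wedge n v (raise k g))) + wedge n v (raise k (bd l (shift l g))))"
    by (simp only: tail_def wedge_linear raise_linear sum.distrib)
  also have "\<dots> = (\<Sum>l<r. if l = k then cscale x g - at_zero k (wedge n v (bd k g)) else 0)"
    by (rule sum.cong[OF refl]) (rule summand, simp)
  also have "\<dots> = cscale x g - at_zero k (wedge n v (bd k g))"
    using k by (simp only: sum.delta' finite_lessThan lessThan_iff sum.delta if_True)
  finally show ?thesis by (simp only: algebra_simps)
qed

lemma supported_bd_wedge: "supported (cells q (Suc d)) g \<Longrightarrow> supported (cells q (Suc d)) (wedge n v (bd k g))"
  by (intro supported_wedge supported_bd)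

text \<open>
  Applying \<open>homotopy\<close> for one index after another multiplies a cycle by \<open>x\<close> and moves it, up to boundaries, into the
  part where one more exponent vanishes. What is left at the end has exponent 0 only; there it equals, up to sign, the
  result of wedging \<open>bds r g\<close> with the vectors \<open>v\<close>, hence it has values in \<open>J\<close>. The index \<open>m\<close> counts the
  exponents still to be treated.
\<close>

lemma tail_boundary_power_aux:
  assumes J: "is_ideal J"
    and v: "\<And>k l. k < r \<Longrightarrow> l < r \<Longrightarrow> (\<Sum>j<n. C l j * v k j) = (if l = k then x else 0)"
  shows "m \<le> r \<Longrightarrow> supported (cells q (Suc d)) g \<Longrightarrow> valued J (tail g) \<Longrightarrow>
    (\<And>\<alpha> K. exponent 0 \<alpha> \<Longrightarrow> bds m g \<alpha> K \<in> J) \<Longrightarrow>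
    (\<And>\<alpha> K. \<exists>k\<ge>m. k < r \<and> \<alpha> k \<noteq> 0 \<Longrightarrow> g \<alpha> K = 0) \<Longrightarrow>
    \<exists>u. supported (cells (Suc q) (Suc (Suc d))) u \<and> valued J (cscale (x ^ m) g - tail u)"
proof (induction m arbitrary: g)
  case 0
  have "g \<alpha> K \<in> J" for \<alpha> K
  proof (cases "\<exists>k<r. \<alpha> k \<noteq> 0")
    case True
    with "0.prems"(5)[of \<alpha> K] is_ideal_zero[OF J] show ?thesis by simp
  next
    case False
    show ?thesis
    proof (cases "\<exists>k\<ge>r. \<alpha> k \<noteq> 0")
      case True
      then have "(\<alpha>, K) \<notin> cells q (Suc d)"
        by (auto simp: cells_def exponent_def)
      with "0.prems"(2) is_ideal_zero[OF J] show ?thesis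
        by (simp add: supported_def)
    next
      case False
      with \<open>\<not> (\<exists>k<r. \<alpha> k \<noteq> 0)\<close> have "exponent 0 \<alpha>"
        by (simp add: exponent_def)
      with "0.prems"(4)[of \<alpha> K] show ?thesis by simp
    qed
  qed
  then have "valued J g"
    unfolding valued_def by blast
  then have "valued J (cscale (x ^ 0) g - tail 0)"
    by (simp only: tail_linear power_0 ext.scale_one diff_0_right)
  then show ?case using supported_0 by blast
next
  case (Suc m)
  then have m: "m < r" by simp
  define h where "h = wedge n (v m) (raise m g)"
  define g' where "g' = at_zero m (wedge n (v m) (bd m g))"
  define e where "e = wedge n (v m) (raise m (tail g))"
  have hom: "cscale x g = tail h + e + g'"
    unfolding h_def e_def g'_def by (rule homotopy[OF m v[OF m]])
  have e: "valued J e"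
    unfolding e_def using Suc.prems(3) J by (intro ideal_linear_valued[OF ideal_linear_wedge] ideal_linear_valued[OF ideal_linear_basic(4)])
  have g': "supported (cells q (Suc d)) g'"
    unfolding g'_def by (intro supported_at_zero supported_bd_wedge Suc.prems)
  have h: "supported (cells (Suc q) (Suc (Suc d))) h"
    unfolding h_def by (intro supported_wedge supported_raise m Suc.prems)
  have "tail g' = cscale x (tail g) - tail e"
  proof -
    have "cscale x (tail g) = tail (tail h) + tail e + tail g'"
      using arg_cong[OF hom, of tail] by (simp only: tail_linear)
    then show ?thesis by (simp only: tail_tail add_0_left add_diff_cancel_left')
  qed
  then have tail_g': "valued J (tail g')"
    using valued_diff[OF J valued_cscale[OF J Suc.prems(3)] ideal_linear_valued[OF ideal_linear_tail J e]]
    by (simp only:)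
  have "bds m g' \<alpha> K \<in> J" if \<alpha>: "exponent 0 \<alpha>" for \<alpha> K
  proof -
    have at: "bds m (at_zero m f) \<alpha> K = bds m f \<alpha> K" for f :: "'a ext" and K
      unfolding bds_at_zero using \<alpha> m by (simp add: at_zero_def exponent_def)
    have "bds m g' \<alpha> K = (- 1) ^ m * wedge n (v m) (bds (Suc m) g) \<alpha> K"
      unfolding g'_def at using bds_wedge[of m "v m" "bd m g"] v[OF m] m by (simp add: cscale_def)
    also have "wedge n (v m) (bds (Suc m) g) \<alpha> K \<in> J"
      using Suc.prems(4)[OF \<alpha>] J unfolding wedge_def sum_ext_apply cscale_def cre_def
      by (intro is_ideal_sum is_ideal_mult) (auto simp: is_ideal_zero intro: is_ideal_mult)
    ultimately show ?thesis using is_ideal_mult[OF J] by simp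
  qed
  moreover have "g' \<alpha> K = 0" if "\<exists>k\<ge>m. k < r \<and> \<alpha> k \<noteq> 0" for \<alpha> K
  proof (cases "\<alpha> m = 0")
    case True
    with that have *: "\<exists>k\<ge>Suc m. k < r \<and> \<alpha> k \<noteq> 0"
      by (metis Suc_leI le_neq_implies_less)
    show ?thesis
      unfolding g'_def at_zero_def wedge_def contr_def sum_ext_apply cscale_def cre_def ann_def Suc.prems(5)[OF *]
      by (simp cong: if_cong)
  qed (simp add: g'_def at_zero_def)
  ultimately obtain u where u: "supported (cells (Suc q) (Suc (Suc d))) u" "valued J (cscale (x ^ m) g' - tail u)"
    using Suc.IH[OF _ g' tail_g'] m by (meson less_imp_le)
  have "cscale (x ^ Suc m) g - tail (cscale (x ^ m) h + u) = cscale (x ^ m) e + (cscale (x ^ m) g' - tail u)"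
  proof -
    have "cscale (x ^ Suc m) g = cscale (x ^ m) (tail h + e + g')"
      unfolding hom[symmetric] by (simp only: ext.scale_scale power_Suc2)
    then show ?thesis by (simp only: tail_linear ext.scale_right_distrib) (simp only: algebra_simps)
  qed
  moreover have "valued J (cscale (x ^ m) e + (cscale (x ^ m) g' - tail u))"
    by (intro valued_add valued_cscale J e u)
  moreover have "supported (cells (Suc q) (Suc (Suc d))) (cscale (x ^ m) h + u)"
    by (intro supported_add supported_cscale h u)
  ultimately show ?case by metis
qed

text \<open>
  In divided degree 0 every element is killed by \<open>tail\<close>; there the next map of the complex is \<open>bds r\<close>.
\<close>

lemma tail_boundary_power:
  assumes J: "is_ideal J"
    and v: "\<And>k l. k < r \<Longrightarrow> l < r \<Longrightarrow> (\<Sum>j<n. C l j * v k j) = (if l = k then x else 0)"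
    and g: "supported (cells q (Suc d)) g" "valued J (tail g)" "q = 0 \<Longrightarrow> valued J (bds r g)"
  shows "\<exists>u. supported (cells (Suc q) (Suc (Suc d))) u \<and> valued J (cscale (x ^ r) g - tail u)"
proof (rule tail_boundary_power_aux[OF J v _ g(1,2)])
  show "bds r g \<alpha> K \<in> J" if \<alpha>: "exponent 0 \<alpha>" for \<alpha> K
  proof (cases "q = 0")
    case False
    with \<alpha> have *: "(\<alpha>, K) \<notin> cells q e" for K e
      by (auto simp: cells_def exponent_def)
    have "supported {(\<alpha>, K). \<alpha> \<in> A} g' \<Longrightarrow> supported {(\<alpha>, K). \<alpha> \<in> A} (bds m g')" for m A g'
    proof (induction m arbitrary: g')
      case (Suc m)
      have "supported {(\<alpha>, K). \<alpha> \<in> A} (ann j g')" for j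
        using Suc.prems by (auto simp: supported_def ann_def)
      then have "supported {(\<alpha>, K). \<alpha> \<in> A} (bd m g')"
        unfolding contr_def by (intro supported_sum supported_cscale)
      from Suc.IH[OF this] show ?case by (simp only: bds.simps)
    qed (simp only: bds.simps)
    from this[of "- {\<alpha>}" g r] g(1) * have "bds r g \<alpha> K = 0"
      by (auto simp: supported_def)
    then show ?thesis using is_ideal_zero[OF J] by simp
  qed (use g(3) in \<open>auto simp: valued_def\<close>)
qed auto

lemma supported_cells_large:
  assumes "n < d" "supported (cells q d) g"
  shows "g = 0"
proof -
  have "(\<alpha>, K) \<notin> cells q d" for \<alpha> K
    using assms(1) card_mono[of "{..<n}" K] by (auto simp: cells_def)
  with assms(2) show ?thesis
    unfolding supported_def by (simp add: fun_eq_iff)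
qed

text \<open>
  Exactness of the tail modulo an initial part of the regular sequence. The number \<open>p\<close> bounds the number of
  steps to the left end of the complex; each step consumes one more element of the sequence.
\<close>

lemma tail_exact:
  assumes xs: "regular_seq xs"
    and v: "\<And>x. x \<in> set xs \<Longrightarrow>
      \<exists>v. \<forall>k<r. \<forall>l<r. (\<Sum>j<n. C l j * v k j) = (if l = k then x else 0)"
  shows "n < Suc d + p \<Longrightarrow> i + p \<le> length xs \<Longrightarrow> supported (cells q (Suc d)) g \<Longrightarrow>
    valued (ideal_span (set (take i xs))) (tail g) \<Longrightarrow>
    (q = 0 \<Longrightarrow> valued (ideal_span (set (take i xs))) (bds r g)) \<Longrightarrow>
    \<exists>u. supported (cells (Suc q) (Suc (Suc d))) u \<and> valued (ideal_span (set (take i xs))) (g - tail u)"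
proof (induction p arbitrary: q d i g)
  case 0
  then have "g = 0"
    using supported_cells_large[of "Suc d" q g] by simp
  moreover have "valued (ideal_span (set (take i xs))) (0 - tail 0)"
    unfolding tail_linear diff_self by (rule valued_0[OF is_ideal_span])
  ultimately show ?case using supported_0 by blast
next
  case (Suc p)
  define J where "J = ideal_span (set (take i xs))"
  define x where "x = xs ! i"
  define J' where "J' = ideal_span (set (take (Suc i) xs))"
  have i: "i < length xs"
    using Suc.prems(2) by simp
  have set_take: "set (take (Suc i) xs) = insert x (set (take i xs))"
    using i by (auto simp: take_Suc_conv_app_nth x_def)
  have J: "is_ideal J" and J': "is_ideal J'" "J \<subseteq> J'" "x \<in> J'"
    unfolding J_def J'_def set_take by (auto intro: ideal_span_base ideal_span_mono[THEN subsetD])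
  have J'_imp: "\<exists>b. a - x * b \<in> J" if "a \<in> J'" for a
    using that unfolding J_def J'_def set_take ideal_span_insert by (simp add: mult.commute)
  have nzd: "a \<in> J" if "x * a \<in> J" for a
    using xs i that unfolding regular_seq_def x_def J_def by blast
  obtain w where w: "\<And>k l. k < r \<Longrightarrow> l < r \<Longrightarrow> (\<Sum>j<n. C l j * w k j) = (if l = k then x else 0)"
    using v[of x] i by (auto simp: x_def)
  have "\<exists>u. supported (cells (Suc q) (Suc (Suc d))) u \<and> valued J (cscale (x ^ r) g - tail u)"
    using Suc.prems(3-5) unfolding J_def[symmetric] by (intro tail_boundary_power[OF J w]) auto
  moreover have "\<exists>z. supported (cells (Suc q) (Suc (Suc d))) z \<and> tail z = 0 \<and> valued J' (u - z)"
    if u: "supported (cells (Suc q) (Suc (Suc d))) u" "valued J' (tail u)" for u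
  proof -
    have "n < Suc (Suc d) + p" "Suc i + p \<le> length xs"
      using Suc.prems(1,2) by auto
    moreover have "valued (ideal_span (set (take (Suc i) xs))) (bds r u)" if "Suc q = 0"
      using that by simp
    ultimately obtain t where t: "supported (cells (Suc (Suc q)) (Suc (Suc (Suc d)))) t" "valued J' (u - tail t)"
      using Suc.IH[of "Suc d" "Suc i" "Suc q" u] u unfolding J'_def by blast
    from supported_tail[OF t(1)] tail_tail[of t] t(2) show ?thesis by blast
  qed
  ultimately show ?case
    unfolding J_def[symmetric] using boundary_cancel_power[OF J J' J'_imp nzd ideal_linear_tail] by blast
qed

fun wedges :: "(nat \<Rightarrow> nat \<Rightarrow> 'a) \<Rightarrow> nat \<Rightarrow> 'a ext \<Rightarrow> 'a ext" where
  "wedges v 0 g = g"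
| "wedges v (Suc m) g = wedge n (v m) (wedges v m g)"

lemma supported_wedges: "supported (cells q d) g \<Longrightarrow> supported (cells q (m + d)) (wedges v m g)"
  by (induction m) (auto intro: supported_wedge)

text \<open>
  Wedging a cycle with the \<open>r\<close> vectors that express \<open>x t\<^sub>k\<close> inverts \<open>bds r\<close> up to the factor \<open>x\<^sup>r\<close>.
\<close>

lemma bds_wedges:
  assumes v: "\<And>k l. k < r \<Longrightarrow> l < r \<Longrightarrow> (\<Sum>j<n. C l j * v k j) = (if l = k then x else 0)"
    and w: "\<And>k. k < r \<Longrightarrow> bd k w = 0"
  shows "m \<le> r \<Longrightarrow> bds m (wedges v m w) = cscale (x ^ m) w"
proof -
  have bd: "bd l (wedges v m w) = 0" if "m \<le> l" "l < r" for l m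
    using that
    by (induction m) (simp_all add: w contr_wedge v wedge_linear)
  show "m \<le> r \<Longrightarrow> bds m (wedges v m w) = cscale (x ^ m) w"
  proof (induction m)
    case (Suc m)
    then have "bd m (wedges v (Suc m) w) = cscale x (wedges v m w)"
      by (simp add: contr_wedge v bd wedge_linear)
    then show ?case
      using Suc by (simp add: bds_linear)
  qed simp
qed

text \<open>
  Exactness of the Buchsbaum-Rim complex in exterior degree 1. The first element of the sequence is used here, the
  other \<open>n - r\<close> in \<open>tail_exact\<close>.
\<close>

theorem first_syzygies:
  assumes xs: "regular_seq xs" "r \<le> n" "n - r + 1 \<le> length xs"
    and v: "\<And>x. x \<in> set xs \<Longrightarrow>
      \<exists>v. \<forall>k<r. \<forall>l<r. (\<Sum>j<n. C l j * v k j) = (if l = k then x else 0)"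
    and w: "supported (cells 0 1) w" "\<And>k. k < r \<Longrightarrow> bd k w = 0"
  shows "\<exists>g. w = bds r g"
proof -
  define x where "x = xs ! 0"
  define J where "J = ideal_span (set (take 1 xs))"
  have len: "0 < length xs" using xs(3) by linarith
  then have set_take: "set (take 1 xs) = {x}"
    by (cases xs) (auto simp: x_def)
  have J: "is_ideal J" "{0} \<subseteq> J" "x \<in> J"
    unfolding J_def set_take by (auto intro: ideal_span_base is_ideal_zero)
  have zero: "is_ideal {0 :: 'a}"
    using is_ideal_span[of "{}"] by simp
  have J_imp: "\<exists>b. a - x * b \<in> {0}" if "a \<in> J" for a
    using that unfolding J_def set_take ideal_span_insert by (simp add: mult.commute)
  have nzd: "a \<in> {0}" if "x * a \<in> {0}" for a
    using xs(1) len that unfolding regular_seq_def x_def by force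
  obtain v' where v': "\<And>k l. k < r \<Longrightarrow> l < r \<Longrightarrow> (\<Sum>j<n. C l j * v' k j) = (if l = k then x else 0)"
    using v[of x] len by (auto simp: x_def)
  have "cscale (x ^ r) w - bds r (wedges v' r w) = 0"
    using bds_wedges[OF v' w(2), of r] by simp
  moreover have "supported (cells 0 (r + 1)) (wedges v' r w)"
    by (rule supported_wedges[OF w(1)])
  ultimately have "\<exists>u. supported (cells 0 (Suc r)) u \<and> valued {0} (cscale (x ^ r) w - bds r u)"
    by (metis Suc_eq_plus1 valued_0[OF zero])
  moreover have "\<exists>z. supported (cells 0 (Suc r)) z \<and> bds r z = 0 \<and> valued J (u - z)"
    if u: "supported (cells 0 (Suc r)) u" "valued J (bds r u)" for u
  proof -
    have "tail u = 0"
    proof -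
      have "shift k u = 0" if "k < r" for k
      proof -
        have "(\<alpha>(k := Suc (\<alpha> k)), K) \<notin> cells 0 (Suc r)" for \<alpha> K
          using that by (auto simp: cells_def exponent_def intro!: bexI[of _ k])
        with u(1) show ?thesis
          by (auto simp: shift_def supported_def fun_eq_iff)
      qed
      then show ?thesis
        unfolding tail_def by (simp add: contr_linear)
    qed
    then have "valued J (tail u)"
      using valued_0[OF J(1)] by simp
    with u obtain t where t: "supported (cells 1 (Suc (Suc r))) t" "valued J (u - tail t)"
      using tail_exact[OF xs(1) v, of r "n - r" 1 0 u] xs(2,3) unfolding J_def by auto
    from supported_tail[of 0 "Suc r" t] bds_tail[of t] t show ?thesis by auto
  qed
  ultimately obtain u where "valued {0} (w - bds r u)"
    using boundary_cancel_power[OF zero J J_imp nzd ideal_linear_bds] by blast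
  then have "w = bds r u"
    by (simp add: valued_def fun_eq_iff)
  then show ?thesis by blast
qed

lemma bd_at_empty: "bd l w \<alpha> {} = (\<Sum>j<n. C l j * w \<alpha> {j})"
  by (simp add: contr_def sum_ext_apply cscale_def ann_def alt_sign_def)

lemma syzygy_in_image:
  assumes xs: "regular_seq xs" "r \<le> n" "n - r + 1 \<le> length xs"
    and v: "\<And>x. x \<in> set xs \<Longrightarrow>
      \<exists>v. \<forall>k<r. \<forall>l<r. (\<Sum>j<n. C l j * v k j) = (if l = k then x else 0)"
    and u: "\<And>k. k < r \<Longrightarrow> (\<Sum>j<n. C k j * u j) = 0"
  shows "\<exists>g. \<forall>j<n. u j = bds r g (\<lambda>_. 0) {j}"
proof -
  define w where "w = (\<lambda>(\<alpha> :: nat \<Rightarrow> nat) K. if \<alpha> = (\<lambda>_. 0) \<and> (\<exists>j<n. K = {j}) then u (the_elem K) else 0)"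
  have w: "supported (cells 0 1) w"
    by (auto simp: supported_def w_def cells_def exponent_def)
  have "bd k w = 0" if "k < r" for k
  proof -
    have "bd k w \<alpha> K = 0" for \<alpha> K
    proof (cases "K = {}")
      case True
      have "bd k w \<alpha> {} = (\<Sum>j<n. C k j * (if \<alpha> = (\<lambda>_. 0) then u j else 0))"
        unfolding bd_at_empty by (rule sum.cong) (auto simp: w_def)
      with True u[OF that] show ?thesis by (cases "\<alpha> = (\<lambda>_. 0)") simp_all
    next
      case False
      then have "(\<alpha>, K) \<notin> cells 0 0"
        using finite_subset[of K "{..<n}"] by (auto simp: cells_def)
      with supported_bd[of 0 0 w k] w show ?thesis
        by (simp add: supported_def)
    qed
    then show ?thesis by (simp add: fun_eq_iff)
  qed
  from first_syzygies[OF xs v w this] obtain g where g: "w = bds r g" by blast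
  have "u j = bds r g (\<lambda>_. 0) {j}" if "j < n" for j
    unfolding g[symmetric] using that by (simp add: w_def)
  then show ?thesis by blast
qed

text \<open>
  Contracting with all rows but the \<open>k\<close>-th gives, up to sign, an element \<open>w\<close> that the other rows kill and that the
  \<open>k\<close>-th row sends to \<open>bds m g\<close>. The induction obtains this product with one factor omitted without forming it.
\<close>

lemma bds_as_boundary:
  "k < m \<Longrightarrow> \<exists>w. \<forall>l<m. bd l w = (if l = k then bds m g else 0)"
proof (induction m)
  case (Suc m)
  show ?case
  proof (cases "k = m")
    case True
    have "bd l (cscale ((- 1) ^ m) (bds m g)) = (if l = k then bds (Suc m) g else 0)" if "l < Suc m" for l
    proof (cases "l = m")
      case False
      with that True show ?thesis by (simp add: contr_linear bd_bds_0)
    qed (simp add: True contr_linear bd_bds flip: power_mult_distrib)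
    then show ?thesis by blast
  next
    case False
    with Suc obtain w where w: "\<forall>l<m. bd l w = (if l = k then bds m g else 0)"
      by auto
    have "bd l (cscale ((- 1) ^ Suc m) (bd m w)) = (if l = k then bds (Suc m) g else 0)" if "l < Suc m" for l
    proof (cases "l = m")
      case True
      with False show ?thesis by (simp add: contr_linear contr_contr_same)
    next
      case False
      with that w have "bd m (bd l w) = (if l = k then bd m (bds m g) else 0)"
        by (simp add: contr_linear)
      then show ?thesis
        by (simp add: contr_linear contr_contr[of n "C l" n "C m"] bd_bds flip: power_mult_distrib)
    qed
    then show ?thesis by blast
  qed
qed simp

text \<open>
  In exterior degree 1, \<open>bds_as_boundary\<close> exhibits the entry times \<open>t\<^sub>k\<close> as a combination of the columns.
\<close>

lemma image_entry_kills_cokernel: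
  assumes "k < r"
  shows "\<exists>v. \<forall>l<r. (\<Sum>j<n. C l j * v j) = (if l = k then bds r g (\<lambda>_. 0) {i} else 0)"
proof -
  obtain w where w: "\<forall>l<r. bd l w = (if l = k then bds r (ann i g) else 0)"
    using bds_as_boundary[OF assms] by blast
  have entry: "(- 1) ^ r * bds r (ann i g) (\<lambda>_. 0) {} = bds r g (\<lambda>_. 0) {i}"
  proof -
    have "cscale ((- 1) ^ r) (bds r (ann i g)) (\<lambda>_. 0) {} = ann i (bds r g) (\<lambda>_. 0) {}"
      by (simp only: ann_bds)
    then show ?thesis
      by (simp add: cscale_def ann_def alt_sign_def)
  qed
  have "(\<Sum>j<n. C l j * ((- 1) ^ r * w (\<lambda>_. 0) {j})) = (if l = k then bds r g (\<lambda>_. 0) {i} else 0)"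
    if "l < r" for l
  proof -
    have "(\<Sum>j<n. C l j * ((- 1) ^ r * w (\<lambda>_. 0) {j})) = (- 1) ^ r * bd l w (\<lambda>_. 0) {}"
      unfolding bd_at_empty sum_distrib_left by (rule sum.cong) (simp_all add: mult_ac)
    with w that entry show ?thesis by auto
  qed
  then show ?thesis by (intro exI[of _ "\<lambda>j. (- 1) ^ r * w (\<lambda>_. 0) {j}"]) simp
qed

text \<open>
  Each contraction contributes one factor in \<open>I\<close>.
\<close>

lemma image_entry_in_square:
  assumes I: "is_ideal I" and C: "\<And>k j. k < r \<Longrightarrow> j < n \<Longrightarrow> C k j \<in> I" and r: "2 \<le> r"
  shows "bds r g \<alpha> K \<in> ideal_span {a * b | a b. a \<in> I \<and> b \<in> I}"
proof -
  obtain m where m: "r = Suc (Suc m)"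
    using r by (metis Suc_le_D numeral_2_eq_2 Suc_le_mono)
  define I2 where "I2 = ideal_span {a * b | a b. a \<in> I \<and> b \<in> I}"
  have I2: "is_ideal I2" "\<And>a b. a \<in> I \<Longrightarrow> b \<in> I \<Longrightarrow> a * b \<in> I2"
    unfolding I2_def by (auto intro: ideal_span_base)
  have 1: "valued I (bd k f)" if "k < r" for k f
    unfolding valued_def contr_def sum_ext_apply cscale_def
    using C[OF that] I by (auto intro!: is_ideal_sum is_ideal_mult_right)
  have 2: "valued I2 (bd k f)" if "k < r" "valued I f" for k f
  proof -
    have "ann j f \<alpha> K \<in> I" for j \<alpha> K
      using ideal_linear_valued[OF ideal_linear_basic(1) I that(2)] unfolding valued_def by blast
    then show ?thesis
      unfolding valued_def contr_def sum_ext_apply cscale_def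
      using C[OF that(1)] by (auto intro!: is_ideal_sum I2)
  qed
  have "valued I2 (bd m (bd (Suc m) g))"
    using m by (intro 2 1) auto
  from ideal_linear_valued[OF ideal_linear_bds I2(1) this] show ?thesis
    unfolding m I2_def valued_def by simp
qed

text \<open>
  For one row this is the Koszul complex, whose alternating relations have no diagonal term.
\<close>

lemma image_entry_single_row:
  assumes "r = 1"
  shows "bds r g \<alpha> {i} \<in> ideal_span (C 0 ` ({..<n} - {i}))"
proof -
  have "bds r g \<alpha> {i} = (\<Sum>j<n. C 0 j * ann j g \<alpha> {i})"
    using assms by (simp add: contr_def sum_ext_apply cscale_def)
  also have "\<dots> \<in> ideal_span (C 0 ` ({..<n} - {i}))"
  proof (rule is_ideal_sum[OF is_ideal_span])
    fix j assume "j \<in> {..<n}"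
    then show "C 0 j * ann j g \<alpha> {i} \<in> ideal_span (C 0 ` ({..<n} - {i}))"
      by (cases "j = i") (auto simp: ann_def is_ideal_zero intro!: is_ideal_mult_right[OF is_ideal_span ideal_span_base])
  qed
  finally show ?thesis .
qed

end

section \<open>Noetherian rings\<close>

lemma noetherian_maximal:
  fixes F :: "'a::comm_ring_1 set set"
  assumes noeth: "noetherian TYPE('a)" and F: "F \<noteq> {}" "\<And>I. I \<in> F \<Longrightarrow> is_ideal I"
  shows "\<exists>M\<in>F. \<forall>I\<in>F. M \<subseteq> I \<longrightarrow> I = M"
  proof (rule subset_Zorn_nonempty[OF F(1)])
    fix \<C> assume \<C>: "\<C> \<noteq> {}" "subset.chain F \<C>"
    then have sub: "\<C> \<subseteq> F" and lin: "\<And>X Y. X \<in> \<C> \<Longrightarrow> Y \<in> \<C> \<Longrightarrow> X \<subseteq> Y \<or> Y \<subseteq> X"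
      by (auto simp: subset_chain_def)
    have "is_ideal (\<Union>\<C>)"
    proof (rule is_idealI)
      show "0 \<in> \<Union>\<C>"
      proof -
        obtain Z where "Z \<in> \<C>" using \<C>(1) by blast
        with is_ideal_zero[of Z] F(2) sub show ?thesis by blast
      qed
      show "a + b \<in> \<Union>\<C>" if ab: "a \<in> \<Union>\<C>" "b \<in> \<Union>\<C>" for a b
      proof -
        from ab obtain X Y where XY: "X \<in> \<C>" "Y \<in> \<C>" "a \<in> X" "b \<in> Y" by blast
        with lin[of X Y] obtain Z where Z: "Z \<in> \<C>" "a \<in> Z" "b \<in> Z" by blast
        with sub F(2) have "is_ideal Z" by blast
        from is_ideal_add[OF this Z(2,3)] Z(1) show ?thesis by (rule UnionI[rotated])
      qed
      show "c * a \<in> \<Union>\<C>" if "a \<in> \<Union>\<C>" for a c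
      proof -
        from that obtain Z where Z: "Z \<in> \<C>" "a \<in> Z" by blast
        with sub F(2) have "is_ideal Z" by blast
        from is_ideal_mult[OF this Z(2)] Z(1) show ?thesis by (rule UnionI[rotated])
      qed
    qed
    from noeth[unfolded noetherian_def, rule_format, OF this]
    obtain X where X: "finite X" "\<Union>\<C> = ideal_span X" by (elim exE conjE)
    have "X \<subseteq> \<Union>\<C>"
      unfolding X(2) by (rule subsetI) (rule ideal_span_base)
    then obtain I where I: "I \<in> \<C>" "X \<subseteq> I"
      by (rule finite_subset_Union_chain[OF X(1) _ \<C>])
    have "\<Union>\<C> \<subseteq> I"
      unfolding X(2) by (rule ideal_span_minimal) (use I sub F(2) in blast)+
    with I(1) have "\<Union>\<C> = I" by blast
    with I(1) sub show "\<Union>\<C> \<in> F" by blast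
  qed

lemma is_ideal_plus_principal: "is_ideal I \<Longrightarrow> is_ideal {a. \<exists>b. a - b * x \<in> I}"
proof (rule is_idealI; clarify?)
  assume I: "is_ideal I"
  show "\<exists>b. 0 - b * x \<in> I"
    using is_ideal_zero[OF I] by (intro exI[of _ 0]) simp
  show "\<exists>b. a + a' - b * x \<in> I" if "a - b * x \<in> I" "a' - b' * x \<in> I" for a a' b b'
    using is_ideal_add[OF I that] by (intro exI[of _ "b + b'"]) (simp add: algebra_simps)
  show "\<exists>b. c * a - b * x \<in> I" if "a - b * x \<in> I" for a b c
    using is_ideal_mult[OF I that, of c] by (intro exI[of _ "c * b"]) (simp add: algebra_simps)
qed

lemma plus_principal:
  assumes "is_ideal I"
  shows "I \<subseteq> {a. \<exists>b. a - b * x \<in> I}" "x \<in> {a. \<exists>b. a - b * x \<in> I}"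
proof -
  have "a - 0 * x \<in> I" if "a \<in> I" for a using that by simp
  then show "I \<subseteq> {a. \<exists>b. a - b * x \<in> I}" by blast
  have "x - 1 * x \<in> I" using is_ideal_zero[OF assms] by simp
  then show "x \<in> {a. \<exists>b. a - b * x \<in> I}" by blast
qed

lemma prime_avoiding:
  fixes J :: "'a::comm_ring_1 set"
  assumes noeth: "noetherian TYPE('a)" and J: "is_ideal J"
    and T: "1 \<in> T" "\<And>s t. s \<in> T \<Longrightarrow> t \<in> T \<Longrightarrow> s * t \<in> T" "J \<inter> T = {}"
  obtains Q where "is_prime_ideal Q" "J \<subseteq> Q" "Q \<inter> T = {}"
proof -
  obtain Q where Q: "is_ideal Q" "J \<subseteq> Q" "Q \<inter> T = {}"
    and max: "\<And>I. is_ideal I \<Longrightarrow> J \<subseteq> I \<Longrightarrow> I \<inter> T = {} \<Longrightarrow> Q \<subseteq> I \<Longrightarrow> I = Q"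
  proof -
    have "\<exists>Q\<in>{I. is_ideal I \<and> J \<subseteq> I \<and> I \<inter> T = {}}. \<forall>I\<in>{I. is_ideal I \<and> J \<subseteq> I \<and> I \<inter> T = {}}. Q \<subseteq> I \<longrightarrow> I = Q"
      by (rule noetherian_maximal[OF noeth]) (use J T(3) in auto)
    then obtain Q where Q: "Q \<in> {I. is_ideal I \<and> J \<subseteq> I \<and> I \<inter> T = {}}"
      and max: "\<forall>I\<in>{I. is_ideal I \<and> J \<subseteq> I \<and> I \<inter> T = {}}. Q \<subseteq> I \<longrightarrow> I = Q" ..
    show ?thesis
      by (rule that[of Q]) (use Q max in simp_all)
  qed
  have meets: "\<exists>s\<in>T. \<exists>b. s - b * a \<in> Q" if "a \<notin> Q" for a
  proof (rule ccontr)
    assume *: "\<not> (\<exists>s\<in>T. \<exists>b. s - b * a \<in> Q)"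
    have "{c. \<exists>b. c - b * a \<in> Q} = Q"
    proof (rule max[OF is_ideal_plus_principal[OF Q(1)]])
      show "Q \<subseteq> {c. \<exists>b. c - b * a \<in> Q}"
        by (rule plus_principal(1)[OF Q(1)])
      with Q(2) show "J \<subseteq> {c. \<exists>b. c - b * a \<in> Q}"
        by (rule subset_trans)
      show "{c. \<exists>b. c - b * a \<in> Q} \<inter> T = {}"
        using * by blast
    qed
    with plus_principal(2)[OF Q(1), of a] that show False by simp
  qed
  have "a \<in> Q \<or> b \<in> Q" if ab: "a * b \<in> Q" for a b
  proof (rule ccontr)
    assume "\<not> (a \<in> Q \<or> b \<in> Q)"
    then have "a \<notin> Q" "b \<notin> Q" by simp_all
    from meets[OF this(1)] meets[OF this(2)]
    obtain s c t d where st: "s \<in> T" "s - c * a \<in> Q" "t \<in> T" "t - d * b \<in> Q"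
      by (elim bexE exE)
    have "s * t = t * (s - c * a) + (c * a) * (t - d * b) + (c * d) * (a * b)"
      by (simp add: algebra_simps)
    also have "\<dots> \<in> Q"
      by (intro is_ideal_add[OF Q(1)] is_ideal_mult[OF Q(1) st(2)] is_ideal_mult[OF Q(1) st(4)]
          is_ideal_mult[OF Q(1) ab])
    finally show False using T(2)[OF st(1,3)] Q(3) by blast
  qed
  moreover have "Q \<noteq> UNIV" using T(1) Q(3) by blast
  ultimately have "is_prime_ideal Q"
    unfolding is_prime_ideal_def using Q(1) by simp
  from this Q(2,3) show ?thesis by (rule that)
qed

lemma is_prime_idealD:
  assumes "is_prime_ideal P"
  shows "is_ideal P" "1 \<notin> P" "a * b \<in> P \<Longrightarrow> a \<in> P \<or> b \<in> P"
proof -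
  show P: "is_ideal P" using assms by (simp add: is_prime_ideal_def)
  show "1 \<notin> P"
  proof
    assume "1 \<in> P"
    then have "c \<in> P" for c using is_ideal_mult[OF P, of 1 c] by simp
    with assms show False by (auto simp: is_prime_ideal_def)
  qed
  show "a * b \<in> P \<Longrightarrow> a \<in> P \<or> b \<in> P" using assms by (simp add: is_prime_ideal_def)
qed

lemma prime_power: "is_prime_ideal P \<Longrightarrow> a ^ k \<in> P \<Longrightarrow> a \<in> P"
proof (induction k)
  case 0
  then show ?case using is_prime_idealD(2) by auto
next
  case (Suc k)
  then show ?case using is_prime_idealD(3)[of P a "a ^ k"] by auto
qed

text \<open>
  Localization is expressed inside the ring: ideals of the localization at \<open>T\<close> correspond to the ideals \<open>I\<close>
  with \<open>sat T I = I\<close>. For \<open>T = - P\<close> they are the ideals of the local ring at \<open>P\<close>.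
\<close>

definition mult_closed :: "'a::comm_ring_1 set \<Rightarrow> bool" where
  "mult_closed T \<longleftrightarrow> 1 \<in> T \<and> (\<forall>s\<in>T. \<forall>t\<in>T. s * t \<in> T)"

definition sat :: "'a::comm_ring_1 set \<Rightarrow> 'a set \<Rightarrow> 'a set" where
  "sat T I = {a. \<exists>s\<in>T. s * a \<in> I}"

lemma mult_closed_compl_prime: "is_prime_ideal P \<Longrightarrow> mult_closed (- P)"
  unfolding mult_closed_def using is_prime_idealD(2,3)[of P] by blast

lemma mult_closed_powers:
  assumes "mult_closed T"
  shows "mult_closed {s * x ^ k | s k. s \<in> T}"
  unfolding mult_closed_def
proof (intro conjI ballI)
  have "1 = 1 * x ^ 0" by simp
  then show "1 \<in> {s * x ^ k | s k. s \<in> T}"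
    using assms unfolding mult_closed_def by blast
  show "a * b \<in> {s * x ^ k | s k. s \<in> T}" if ab: "a \<in> {s * x ^ k | s k. s \<in> T}" "b \<in> {s * x ^ k | s k. s \<in> T}" for a b
  proof -
    from ab obtain s k t l where st: "s \<in> T" "a = s * x ^ k" "t \<in> T" "b = t * x ^ l" by blast
    then have "a * b = (s * t) * x ^ (k + l)" by (simp add: power_add mult_ac)
    moreover have "s * t \<in> T" using assms st unfolding mult_closed_def by blast
    ultimately show ?thesis by blast
  qed
qed

lemma powers_superset: "T \<subseteq> {s * x ^ k | s k. s \<in> T}" for T :: "'a::comm_ring_1 set"
proof
  fix s assume "s \<in> T"
  moreover have "s = s * x ^ 0" by simp
  ultimately show "s \<in> {s * x ^ k | s k. s \<in> T}" by blast
qed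

lemma powers_base: "mult_closed T \<Longrightarrow> x \<in> {s * x ^ k | s k. s \<in> T}" for T :: "'a::comm_ring_1 set"
proof -
  assume "mult_closed T"
  moreover have "x = 1 * x ^ 1" by simp
  ultimately show ?thesis unfolding mult_closed_def by blast
qed

lemma is_ideal_sat:
  assumes T: "mult_closed T" and I: "is_ideal I"
  shows "is_ideal (sat T I)"
proof (rule is_idealI)
  have "1 * 0 \<in> I" using is_ideal_zero[OF I] by simp
  then show "0 \<in> sat T I"
    using T unfolding sat_def mult_closed_def by blast
  show "a + b \<in> sat T I" if "a \<in> sat T I" "b \<in> sat T I" for a b
  proof -
    from that obtain s t where st: "s \<in> T" "s * a \<in> I" "t \<in> T" "t * b \<in> I" unfolding sat_def by blast
    have "(s * t) * (a + b) = t * (s * a) + s * (t * b)" by (simp add: algebra_simps)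
    then have "(s * t) * (a + b) \<in> I"
      using is_ideal_add[OF I is_ideal_mult[OF I st(2), of t] is_ideal_mult[OF I st(4), of s]] by simp
    moreover have "s * t \<in> T" using st T unfolding mult_closed_def by blast
    ultimately show ?thesis unfolding sat_def by blast
  qed
  show "c * a \<in> sat T I" if "a \<in> sat T I" for a c
  proof -
    from that obtain s where s: "s \<in> T" "s * a \<in> I" unfolding sat_def by blast
    from is_ideal_mult[OF I s(2), of c] have "s * (c * a) \<in> I" by (simp add: mult.left_commute)
    with s(1) show ?thesis unfolding sat_def by blast
  qed
qed

lemma sat_superset:
  assumes "mult_closed T"
  shows "I \<subseteq> sat T I"
proof
  fix a assume "a \<in> I"
  then have "1 * a \<in> I" by simp
  with assms show "a \<in> sat T I" unfolding sat_def mult_closed_def by blast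
qed

lemma sat_mono: "T \<subseteq> T' \<Longrightarrow> I \<subseteq> I' \<Longrightarrow> sat T I \<subseteq> sat T' I'"
  unfolding sat_def by blast

lemma sat_sat:
  assumes "mult_closed T"
  shows "sat T (sat T I) = sat T I"
proof
  show "sat T (sat T I) \<subseteq> sat T I"
  proof
    fix a assume "a \<in> sat T (sat T I)"
    then obtain s t where "s \<in> T" "t \<in> T" "t * (s * a) \<in> I" unfolding sat_def by blast
    then have "t * s \<in> T" "(t * s) * a \<in> I"
      using assms by (simp_all add: mult_closed_def mult.assoc)
    then show "a \<in> sat T I" unfolding sat_def by blast
  qed
qed (rule sat_superset[OF assms])

lemma sat_smaller:
  assumes "mult_closed T" "S \<subseteq> T" "mult_closed S"
  shows "sat S (sat T I) = sat T I"
  using sat_mono[OF assms(2) subset_refl, of "sat T I"] sat_sat[OF assms(1), of I] sat_superset[OF assms(3), of "sat T I"]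
  by simp

text \<open>
  If \<open>Y\<close> were not contained in \<open>K\<close>, choose \<open>K'\<close> maximal among the saturated ideals above \<open>K\<close> that do not contain
  \<open>Y\<close>, and \<open>a \<in> Y - K'\<close>. Then \<open>Y\<close> lies in the saturation of \<open>K' + (a)\<close>, so the hypothesis gives \<open>s a \<in> K' + P a\<close>
  with \<open>s \<notin> P\<close>, whence \<open>a \<in> K'\<close>.
\<close>

lemma saturated_Nakayama:
  fixes P :: "'a::comm_ring_1 set"
  assumes noeth: "noetherian TYPE('a)" and P: "is_prime_ideal P"
    and K: "is_ideal K" "sat (- P) K = K" and Y: "is_ideal Y" "K \<subseteq> Y"
    and nak: "\<And>a. a \<in> Y \<Longrightarrow> a \<in> sat (- P) {b. \<exists>k\<in>K. b - k \<in> ideal_span {p * y | p y. p \<in> P \<and> y \<in> Y}}"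
  shows "Y \<subseteq> K"
proof -
  note T = mult_closed_compl_prime[OF P]
  show ?thesis
  proof (rule ccontr)
    assume nsub: "\<not> Y \<subseteq> K"
    obtain K' where K': "is_ideal K'" "sat (- P) K' = K'" "K \<subseteq> K'" "\<not> Y \<subseteq> K'"
      and max: "\<And>I. is_ideal I \<Longrightarrow> sat (- P) I = I \<Longrightarrow> K \<subseteq> I \<Longrightarrow> \<not> Y \<subseteq> I \<Longrightarrow> K' \<subseteq> I \<Longrightarrow> I = K'"
    proof -
      let ?F = "{I. is_ideal I \<and> sat (- P) I = I \<and> K \<subseteq> I \<and> \<not> Y \<subseteq> I}"
      have "\<exists>M\<in>?F. \<forall>I\<in>?F. M \<subseteq> I \<longrightarrow> I = M"
        by (rule noetherian_maximal[OF noeth]) (use K nsub in auto)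
      then obtain K' where K': "K' \<in> ?F" and max: "\<forall>I\<in>?F. K' \<subseteq> I \<longrightarrow> I = K'" ..
      show ?thesis
        by (rule that[of K']) (use K' max in simp_all)
    qed
    obtain a where a: "a \<in> Y" "a \<notin> K'" using K'(4) by blast
    define L where "L = sat (- P) {c. \<exists>b. c - b * a \<in> K'}"
    have L: "is_ideal L" "sat (- P) L = L"
      unfolding L_def by (rule is_ideal_sat[OF T is_ideal_plus_principal[OF K'(1)]], rule sat_sat[OF T])
    have L': "K' \<subseteq> L" "a \<in> L"
      unfolding L_def using plus_principal[OF K'(1), of a] sat_superset[OF T, of "{c. \<exists>b. c - b * a \<in> K'}"]
      by blast+
    have YL: "Y \<subseteq> L"
      using max[OF L _ _ L'(1)] L'(2) a(2) K'(3) L'(1) by blast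
    define H where "H = sat (- P) {c. \<exists>p\<in>P. c - p * a \<in> K'}"
    have H: "is_ideal H"
      unfolding H_def
    proof (rule is_ideal_sat[OF T], rule is_idealI; clarify?)
      note P' = is_prime_idealD(1)[OF P]
      show "\<exists>p\<in>P. 0 - p * a \<in> K'"
        using is_ideal_zero[OF K'(1)] is_ideal_zero[OF P'] by (intro bexI[of _ 0]) auto
      show "\<exists>p\<in>P. c + c' - p * a \<in> K'" if "p \<in> P" "p' \<in> P" "c - p * a \<in> K'" "c' - p' * a \<in> K'" for c c' p p'
        using is_ideal_add[OF K'(1) that(3,4)] is_ideal_add[OF P' that(1,2)]
        by (intro bexI[of _ "p + p'"]) (auto simp: algebra_simps)
      show "\<exists>p\<in>P. d * c - p * a \<in> K'" if "p \<in> P" "c - p * a \<in> K'" for c d p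
        using is_ideal_mult[OF K'(1) that(2), of d] is_ideal_mult[OF P' that(1), of d]
        by (intro bexI[of _ "d * p"]) (auto simp: algebra_simps)
    qed
    have "p * y \<in> H" if p: "p \<in> P" and y: "y \<in> Y" for p y
    proof -
      obtain s b where s: "s \<notin> P" "s * y - b * a \<in> K'"
        using y YL by (auto simp: L_def sat_def)
      have "s * (p * y) - (p * b) * a = p * (s * y - b * a)"
        by (simp add: algebra_simps)
      also have "\<dots> \<in> K'" by (rule is_ideal_mult[OF K'(1) s(2)])
      finally show ?thesis
        using s(1) is_ideal_mult_right[OF is_prime_idealD(1)[OF P] p, of b] by (auto simp: H_def sat_def)
    qed
    then have span: "ideal_span {p * y | p y. p \<in> P \<and> y \<in> Y} \<subseteq> H"
      by (intro ideal_span_minimal[OF H]) auto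
    have "K' \<subseteq> H"
      unfolding H_def
    proof (rule subset_trans[OF _ sat_superset[OF T]], rule subsetI)
      fix c assume "c \<in> K'"
      then have "c - 0 * a \<in> K'" by simp
      then show "c \<in> {c. \<exists>p\<in>P. c - p * a \<in> K'}" using is_ideal_zero[OF is_prime_idealD(1)[OF P]] by blast
    qed
    obtain s k where s: "s \<notin> P" "k \<in> K" "s * a - k \<in> ideal_span {p * y | p y. p \<in> P \<and> y \<in> Y}"
      using nak[OF a(1)] by (auto simp: sat_def)
    have "(s * a - k) + k \<in> H"
      using s span K'(3) \<open>K' \<subseteq> H\<close> by (intro is_ideal_add[OF H]) auto
    then obtain t p where t: "t \<notin> P" "p \<in> P" "t * (s * a) - p * a \<in> K'"
      by (auto simp: H_def sat_def)
    then have "(t * s - p) * a \<in> K'"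
      by (simp add: algebra_simps)
    moreover have "t * s - p \<notin> P"
    proof
      assume "t * s - p \<in> P"
      from is_ideal_add[OF is_prime_idealD(1)[OF P] this t(2)] have "t * s \<in> P" by simp
      with is_prime_idealD(3)[OF P] t(1) s(1) show False by blast
    qed
    ultimately have "a \<in> sat (- P) K'" by (auto simp: sat_def)
    with K'(2) a(2) show False by simp
  qed
qed

text \<open>
  An Artinian quotient without lengths, by Noetherian induction on \<open>J\<close>. Take a maximal counterexample \<open>J\<close> and
  an element \<open>a \<notin> J\<close> with \<open>P a \<subseteq> J\<close>, that is a generator of a simple submodule of the localized quotient. The
  descending chain condition holds above \<open>J + (a)\<close>. A chain whose members eventually avoid \<open>a\<close> is recovered, by
  the modular law, from the chain of the \<open>I\<^sub>n + (a)\<close>.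
\<close>

lemma saturated_descending_chain:
  fixes P :: "'a::comm_ring_1 set"
  assumes noeth: "noetherian TYPE('a)" and P: "is_prime_ideal P"
    and J: "is_ideal J" "sat (- P) J = J" "\<And>Q. is_prime_ideal Q \<Longrightarrow> J \<subseteq> Q \<Longrightarrow> Q \<subseteq> P \<Longrightarrow> Q = P"
    and I: "\<And>n :: nat. is_ideal (I n)" "\<And>n. sat (- P) (I n) = I n" "\<And>n. J \<subseteq> I n" "\<And>n. I (Suc n) \<subseteq> I n"
  shows "\<exists>n. I (Suc n) = I n"
proof (rule ccontr)
  note T = mult_closed_compl_prime[OF P]
  define base where "base J \<longleftrightarrow> is_ideal J \<and> sat (- P) J = J \<and>
    (\<forall>Q. is_prime_ideal Q \<and> J \<subseteq> Q \<and> Q \<subseteq> P \<longrightarrow> Q = P)" for J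
  define chain where "chain J I \<longleftrightarrow> (\<forall>n. is_ideal (I n) \<and> sat (- P) (I n) = I n \<and> J \<subseteq> I n \<and> I (Suc n) \<subseteq> I n)"
    for J and I :: "nat \<Rightarrow> 'a set"
  define bad where "bad = {J. base J \<and> (\<exists>I. chain J I \<and> (\<forall>n. I (Suc n) \<noteq> I n))}"
  assume "\<not> ?thesis"
  moreover have "base J" "chain J I"
    unfolding base_def chain_def using J I by auto
  ultimately have "bad \<noteq> {}"
    unfolding bad_def by blast
  moreover have "is_ideal J" if "J \<in> bad" for J
    using that unfolding bad_def base_def by blast
  ultimately have "\<exists>M\<in>bad. \<forall>X\<in>bad. M \<subseteq> X \<longrightarrow> X = M"
    by (rule noetherian_maximal[OF noeth])
  then obtain J where Jbad: "J \<in> bad" and max: "\<And>X. X \<in> bad \<Longrightarrow> J \<subseteq> X \<Longrightarrow> X = J"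
    by blast
  from Jbad have J: "is_ideal J" "sat (- P) J = J"
    and Jmin: "\<And>Q. is_prime_ideal Q \<Longrightarrow> J \<subseteq> Q \<Longrightarrow> Q \<subseteq> P \<Longrightarrow> Q = P"
    unfolding bad_def base_def by blast+
  from Jbad obtain I where chI: "chain J I" and neq: "\<And>n. I (Suc n) \<noteq> I n"
    unfolding bad_def by blast
  then have I: "is_ideal (I n)" "sat (- P) (I n) = I n" "J \<subseteq> I n" "I (Suc n) \<subseteq> I n" for n
    unfolding chain_def by blast+
  have anti: "I (m + n) \<subseteq> I m" for m n
    by (induction n) (use I(4) in auto)
  have "J \<noteq> UNIV"
    using I(3)[of 0] I(3)[of 1] neq[of 0] by auto
  define colon where "colon a = {c. c * a \<in> J}" for a
  have colon: "is_ideal (colon a)" for a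
    unfolding colon_def using J(1)
    by (intro is_idealI) (simp_all add: is_ideal_zero is_ideal_add is_ideal_mult distrib_right mult.assoc)
  have "colon ` (- J) \<noteq> {}" using \<open>J \<noteq> UNIV\<close> by blast
  moreover have "is_ideal X" if "X \<in> colon ` (- J)" for X
    using that colon by blast
  ultimately have "\<exists>M\<in>colon ` (- J). \<forall>X\<in>colon ` (- J). M \<subseteq> X \<longrightarrow> X = M"
    by (rule noetherian_maximal[OF noeth])
  then obtain a where a: "a \<notin> J" and amax: "\<And>b. b \<notin> J \<Longrightarrow> colon a \<subseteq> colon b \<Longrightarrow> colon b = colon a"
    by blast
  \<comment> \<open>a maximal annihilator of a nonzero element of the quotient is prime, so it equals P\<close>
  have "is_prime_ideal (colon a)"
    unfolding is_prime_ideal_def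
  proof (intro conjI allI impI colon)
    have "1 \<notin> colon a" using a by (simp add: colon_def)
    then show "colon a \<noteq> UNIV" by blast
    fix b c assume bc: "b * c \<in> colon a"
    show "b \<in> colon a \<or> c \<in> colon a"
    proof (cases "c * a \<in> J")
      case False
      have "colon a \<subseteq> colon (c * a)"
      proof
        fix d assume "d \<in> colon a"
        then have "c * (d * a) \<in> J" using is_ideal_mult[OF J(1)] by (simp add: colon_def)
        then show "d \<in> colon (c * a)" by (simp add: colon_def mult.left_commute)
      qed
      from amax[OF False this] bc show ?thesis by (auto simp: colon_def mult.assoc)
    qed (simp add: colon_def)
  qed
  moreover have "J \<subseteq> colon a"
    using is_ideal_mult_right[OF J(1)] by (auto simp: colon_def)
  moreover have "colon a \<subseteq> P"
  proof
    fix c assume "c \<in> colon a"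
    then show "c \<in> P"
      using a J(2) unfolding colon_def sat_def by blast
  qed
  ultimately have "colon a = P" by (rule Jmin)
  then have Pa: "p * a \<in> J" if "p \<in> P" for p
    using that by (auto simp: colon_def)
  define plus where "plus I = sat (- P) {c. \<exists>b. c - b * a \<in> I}" for I
  have plus: "is_ideal (plus I)" "sat (- P) (plus I) = plus I" "I \<subseteq> plus I" "a \<in> plus I" if "is_ideal I" for I
  proof -
    note sup = sat_superset[OF T, of "{c. \<exists>b. c - b * a \<in> I}"]
    show "is_ideal (plus I)" "sat (- P) (plus I) = plus I"
      unfolding plus_def by (rule is_ideal_sat[OF T is_ideal_plus_principal[OF that]], rule sat_sat[OF T])
    show "I \<subseteq> plus I"
      unfolding plus_def by (rule subset_trans[OF plus_principal(1)[OF that] sup])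
    show "a \<in> plus I"
      unfolding plus_def by (rule subsetD[OF sup plus_principal(2)[OF that]])
  qed
  have plus_mono: "plus I \<subseteq> plus I'" if "I \<subseteq> I'" for I I'
    unfolding plus_def using that by (intro sat_mono) auto
  have "plus J \<notin> bad"
    using max[of "plus J"] plus(3,4)[OF J(1)] a by blast
  moreover have "base (plus J)"
    unfolding base_def using plus(1,2)[OF J(1)] Jmin[OF _ subset_trans[OF plus(3)[OF J(1)]]] by blast
  ultimately have dcc: "\<exists>n. I' (Suc n) = I' n" if "chain (plus J) I'" for I'
    using that unfolding bad_def by blast
  show False
  proof (cases "\<exists>m. a \<notin> I m")
    case True
    then obtain m where m: "a \<notin> I m" by blast
    have "chain (plus J) (\<lambda>n. plus (I (m + n)))"
      unfolding chain_def
    proof (intro allI conjI)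
      show "plus J \<subseteq> plus (I (m + n))" for n by (rule plus_mono[OF I(3)])
      show "plus (I (m + Suc n)) \<subseteq> plus (I (m + n))" for n
        unfolding add_Suc_right by (rule plus_mono[OF I(4)])
    qed (rule plus(1,2)[OF I(1)])+
    from dcc[OF this] obtain n where n: "plus (I (m + Suc n)) = plus (I (m + n))" by blast
    have "I (m + n) \<subseteq> I (Suc (m + n))"
    proof
      fix u assume u: "u \<in> I (m + n)"
      then have "u \<in> plus (I (Suc (m + n)))"
        using plus(3)[OF I(1)[of "m + n"]] n by auto
      then obtain s b where s: "s \<notin> P" "s * u - b * a \<in> I (Suc (m + n))"
        unfolding plus_def sat_def by blast
      have "b * a = s * u - (s * u - b * a)" by simp
      also have "\<dots> \<in> I (m + n)"
        by (rule is_ideal_diff[OF I(1) is_ideal_mult[OF I(1) u] subsetD[OF I(4) s(2)]])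
      finally have ba: "b * a \<in> I (m + n)" .
      have "b \<in> P"
      proof (rule ccontr)
        assume "b \<notin> P"
        with ba have "a \<in> sat (- P) (I (m + n))" unfolding sat_def by blast
        with I(2) anti m show False by blast
      qed
      from Pa[OF this] I(3) have "b * a \<in> I (Suc (m + n))" by blast
      from is_ideal_add[OF I(1) s(2) this] have "s * u \<in> I (Suc (m + n))" by simp
      with s(1) have "u \<in> sat (- P) (I (Suc (m + n)))" unfolding sat_def by blast
      with I(2) show "u \<in> I (Suc (m + n))" by simp
    qed
    with I(4) neq show False by blast
  next
    case False
    have "plus (I n) = I n" for n
    proof
      show "plus (I n) \<subseteq> I n"
      proof
        fix u assume "u \<in> plus (I n)"
        then obtain s b where s: "s \<notin> P" "s * u - b * a \<in> I n"
          unfolding plus_def sat_def by blast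
        have "b * a \<in> I n" using False is_ideal_mult[OF I(1)] by blast
        from is_ideal_add[OF I(1) s(2) this] have "s * u \<in> I n" by simp
        with s(1) have "u \<in> sat (- P) (I n)" unfolding sat_def by blast
        with I(2) show "u \<in> I n" by simp
      qed
    qed (rule plus(3)[OF I(1)])
    with plus_mono[OF I(3)] have "plus J \<subseteq> I n" for n by metis
    then have "chain (plus J) I"
      unfolding chain_def using I by blast
    from dcc[OF this] neq show False by blast
  qed
qed

section \<open>Krull's height theorem\<close>

text \<open>
  Krull's argument with the powers of one element \<open>y \<in> Q - Q0\<close> in place of the symbolic powers of \<open>Q\<close>. Let
  \<open>Y\<^sub>n = (Q0 + (y\<^sup>n)) : x\<^sup>\<infinity>\<close>, localized at \<open>P\<close>. The chain \<open>Y\<^sub>n + (x)\<close> becomes stationary, so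
  \<open>Y\<^sub>n \<subseteq> Y\<^bsub>n+1\<^esub> + x Y\<^sub>n\<close> because \<open>x\<close> is regular modulo \<open>Y\<^sub>n\<close>, and \<open>Y\<^sub>n = Y\<^bsub>n+1\<^esub>\<close> by Nakayama. Then
  \<open>s x\<^sup>k y\<^sup>n \<in> Q0 + (y\<^bsup>n+1\<^esup>)\<close> with \<open>s \<notin> P\<close>; cancelling \<open>y\<^sup>n\<close> puts \<open>s x\<^sup>k\<close> into \<open>Q\<close>, a contradiction.
\<close>

lemma principal_ideal_theorem:
  fixes P :: "'a::comm_ring_1 set"
  assumes noeth: "noetherian TYPE('a)"
    and primes: "is_prime_ideal Q0" "is_prime_ideal Q" "is_prime_ideal P" "Q0 \<subset> Q" "Q \<subset> P"
    and x: "x \<in> P" "\<And>P'. is_prime_ideal P' \<Longrightarrow> Q0 \<subseteq> P' \<Longrightarrow> P' \<subseteq> P \<Longrightarrow> x \<in> P' \<Longrightarrow> P' = P"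
  shows False
proof -
  note Q0 = is_prime_idealD(1)[OF primes(1)]
  note S = mult_closed_compl_prime[OF primes(3)]
  obtain y where y: "y \<in> Q" "y \<notin> Q0" using primes(4) by blast
  have xQ: "x \<notin> Q" using x(2)[OF primes(2)] primes(4,5) by blast
  define T where "T = {s * x ^ k | s k. s \<in> - P}"
  have T: "mult_closed T" "- P \<subseteq> T" "x \<in> T"
    unfolding T_def by (rule mult_closed_powers[OF S], rule powers_superset, rule powers_base[OF S])
  define Y where "Y n = sat T {a. \<exists>b. a - b * y ^ n \<in> Q0}" for n
  have Y: "is_ideal (Y n)" "sat T (Y n) = Y n" "sat (- P) (Y n) = Y n" for n
    unfolding Y_def by (rule is_ideal_sat[OF T(1) is_ideal_plus_principal[OF Q0]], rule sat_sat[OF T(1)],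
        rule sat_smaller[OF T(1,2) S])
  have Q0Y: "Q0 \<subseteq> Y n" and yY: "y ^ n \<in> Y n" for n
  proof -
    note sup = sat_superset[OF T(1), of "{a. \<exists>b. a - b * y ^ n \<in> Q0}"]
    show "Q0 \<subseteq> Y n" unfolding Y_def by (rule subset_trans[OF plus_principal(1)[OF Q0] sup])
    show "y ^ n \<in> Y n" unfolding Y_def by (rule subsetD[OF sup plus_principal(2)[OF Q0]])
  qed
  have Ydec: "Y (Suc n) \<subseteq> Y n" for n
    unfolding Y_def
  proof (rule sat_mono[OF subset_refl], rule subsetI)
    fix a assume "a \<in> {a. \<exists>b. a - b * y ^ Suc n \<in> Q0}"
    then obtain b where "a - (b * y) * y ^ n \<in> Q0" by (auto simp: mult.assoc)
    then show "a \<in> {a. \<exists>b. a - b * y ^ n \<in> Q0}" by blast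
  qed
  define plus where "plus I = sat (- P) {a. \<exists>b. a - b * x \<in> I}" for I
  have plus: "is_ideal (plus I)" "sat (- P) (plus I) = plus I" "I \<subseteq> plus I" "x \<in> plus I" if "is_ideal I" for I
  proof -
    note sup = sat_superset[OF S, of "{c. \<exists>b. c - b * x \<in> I}"]
    show "is_ideal (plus I)" "sat (- P) (plus I) = plus I"
      unfolding plus_def by (rule is_ideal_sat[OF S is_ideal_plus_principal[OF that]], rule sat_sat[OF S])
    show "I \<subseteq> plus I"
      unfolding plus_def by (rule subset_trans[OF plus_principal(1)[OF that] sup])
    show "x \<in> plus I"
      unfolding plus_def by (rule subsetD[OF sup plus_principal(2)[OF that]])
  qed
  have plus_mono: "plus I \<subseteq> plus I'" if "I \<subseteq> I'" for I I'
    unfolding plus_def using that by (intro sat_mono) auto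
  have "\<exists>n. plus (Y (Suc n)) = plus (Y n)"
  proof (rule saturated_descending_chain[OF noeth primes(3)])
    show "is_ideal (plus Q0)" "sat (- P) (plus Q0) = plus Q0"
      by (rule plus[OF Q0])+
    show "Q' = P" if "is_prime_ideal Q'" "plus Q0 \<subseteq> Q'" "Q' \<subseteq> P" for Q'
      using x(2)[OF that(1)] plus(3,4)[OF Q0] that(2,3) by blast
    show "is_ideal (plus (Y n))" "sat (- P) (plus (Y n)) = plus (Y n)" for n
      by (rule plus[OF Y(1)])+
    show "plus Q0 \<subseteq> plus (Y n)" "plus (Y (Suc n)) \<subseteq> plus (Y n)" for n
      by (rule plus_mono[OF Q0Y], rule plus_mono[OF Ydec])
  qed
  then obtain n where n: "plus (Y (Suc n)) = plus (Y n)" ..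
  have "Y n \<subseteq> Y (Suc n)"
  proof (rule saturated_Nakayama[OF noeth primes(3) Y(1) Y(3) Y(1) Ydec])
    fix a assume a: "a \<in> Y n"
    then have "a \<in> plus (Y (Suc n))"
      using plus(3)[OF Y(1)] n by blast
    then obtain s b where s: "s \<in> - P" "s * a - b * x \<in> Y (Suc n)"
      unfolding plus_def sat_def by blast
    have "b \<in> Y n"
    proof -
      have "x * b = s * a - (s * a - b * x)" by (simp add: mult.commute)
      also have "\<dots> \<in> Y n"
        by (rule is_ideal_diff[OF Y(1) is_ideal_mult[OF Y(1) a] subsetD[OF Ydec s(2)]])
      finally have "b \<in> sat T (Y n)" using T(3) unfolding sat_def by blast
      with Y(2) show ?thesis by simp
    qed
    then have "x * b \<in> {p * y | p y. p \<in> P \<and> y \<in> Y n}"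
      using x(1) by blast
    moreover have "x * b = s * a - (s * a - b * x)" by (simp add: mult.commute)
    ultimately have "s * a - (s * a - b * x) \<in> ideal_span {p * y | p y. p \<in> P \<and> y \<in> Y n}"
      by (simp only: ideal_span_base)
    with s show "a \<in> sat (- P) {b. \<exists>k\<in>Y (Suc n). b - k \<in> ideal_span {p * y | p y. p \<in> P \<and> y \<in> Y n}}"
      unfolding sat_def by blast
  qed
  with yY have "y ^ n \<in> Y (Suc n)" by blast
  then obtain s k b where s: "s \<notin> P" "s * x ^ k * y ^ n - b * y ^ Suc n \<in> Q0"
    unfolding Y_def sat_def T_def by blast
  have "s * x ^ k * y ^ n - b * y ^ Suc n = (s * x ^ k - b * y) * y ^ n"
    by (simp add: algebra_simps)
  with s(2) have "(s * x ^ k - b * y) * y ^ n \<in> Q0" by (simp only:)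
  from is_prime_idealD(3)[OF primes(1) this] have "s * x ^ k - b * y \<in> Q0"
    using prime_power[OF primes(1), of y n] y(2) by blast
  with primes(4) have "s * x ^ k - b * y \<in> Q" by blast
  from is_ideal_add[OF is_prime_idealD(1)[OF primes(2)] this
      is_ideal_mult[OF is_prime_idealD(1)[OF primes(2)] y(1), of b]]
  have "s * x ^ k \<in> Q" by simp
  from is_prime_idealD(3)[OF primes(2) this] prime_power[OF primes(2), of x k] xQ have "s \<in> Q"
    by blast
  with s(1) primes(5) show False by blast
qed

text \<open>
  The inductive step replaces the last prime but one by a prime \<open>Q\<close> with none strictly between \<open>Q\<close> and \<open>P\<close>. Some
  generator \<open>x\<close> is not in \<open>Q\<close>, and \<open>P\<close> is minimal over \<open>Q + (x)\<close>; so every other generator \<open>z\<close> satisfies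
  \<open>s z\<^sup>j \<in> Q + (x)\<close> for some \<open>s \<notin> P\<close>. The resulting elements of \<open>Q\<close>, one fewer in number, have \<open>Q\<close> as a minimal
  prime by the principal ideal theorem.
\<close>

theorem krull_height:
  fixes P :: "'a::comm_ring_1 set"
  assumes noeth: "noetherian TYPE('a)"
  shows "is_prime_ideal P \<Longrightarrow> finite X \<Longrightarrow> card X \<le> e \<Longrightarrow> X \<subseteq> P \<Longrightarrow>
    (\<And>Q. is_prime_ideal Q \<Longrightarrow> X \<subseteq> Q \<Longrightarrow> Q \<subseteq> P \<Longrightarrow> Q = P) \<Longrightarrow>
    (\<And>i. i \<le> k \<Longrightarrow> is_prime_ideal (ps i)) \<Longrightarrow> (\<And>i. i < k \<Longrightarrow> ps i \<subset> ps (Suc i)) \<Longrightarrow> ps k = P \<Longrightarrow> k \<le> e"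
proof (induction e arbitrary: P X ps k)
  case (0 P X ps k)
  show ?case
  proof (cases k)
    case (Suc k')
    have sub: "ps k' \<subset> P"
      using "0.prems"(7)[of k'] "0.prems"(8) Suc by simp
    have "ps k' = P"
    proof (rule "0.prems"(5))
      show "is_prime_ideal (ps k')" using "0.prems"(6)[of k'] Suc by simp
      show "X \<subseteq> ps k'" using "0.prems"(2,3) by simp
      show "ps k' \<subseteq> P" using sub by simp
    qed
    with sub show ?thesis by simp
  qed simp
next
  case (Suc e P X ps k)
  show ?case
  proof (cases k)
    case (Suc k')
    note P = Suc.prems(1)
    note S = mult_closed_compl_prime[OF P]
    have psk': "is_prime_ideal (ps k')" "ps k' \<subset> P"
      using Suc.prems(6)[of k'] Suc.prems(7)[of k'] Suc.prems(8) Suc by auto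
    define F where "F = {Q. is_prime_ideal Q \<and> ps k' \<subseteq> Q \<and> Q \<subset> P}"
    have "\<exists>Q\<in>F. \<forall>Q'\<in>F. Q \<subseteq> Q' \<longrightarrow> Q' = Q"
    proof (rule noetherian_maximal[OF noeth])
      show "F \<noteq> {}" using psk' unfolding F_def by blast
      show "is_ideal Q" if "Q \<in> F" for Q
        using that is_prime_idealD(1)[of Q] unfolding F_def by blast
    qed
    then obtain Q where QF: "Q \<in> F" and QF': "\<forall>Q'\<in>F. Q \<subseteq> Q' \<longrightarrow> Q' = Q" ..
    from QF have Q: "is_prime_ideal Q" "ps k' \<subseteq> Q" "Q \<subset> P"
      unfolding F_def by simp_all
    have Qmax: "Q' = P" if Q': "is_prime_ideal Q'" "Q \<subset> Q'" "Q' \<subseteq> P" for Q'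
    proof (rule ccontr)
      assume "Q' \<noteq> P"
      with Q' Q(2) have "Q' \<in> F" unfolding F_def by auto
      with QF' Q'(2) show False by blast
    qed
    obtain x where x: "x \<in> X" "x \<notin> Q"
      using Suc.prems(5)[OF Q(1)] Q(3) by blast
    have "\<exists>q s j b. q \<in> Q \<and> s \<notin> P \<and> s * z ^ j = q + b * x" if z: "z \<in> P" for z
    proof -
      define T where "T = {s * z ^ j | s j. s \<in> - P}"
      have T: "mult_closed T" "- P \<subseteq> T" "z \<in> T"
        unfolding T_def by (rule mult_closed_powers[OF S], rule powers_superset, rule powers_base[OF S])
      define L where "L = {a. \<exists>b. a - b * x \<in> Q}"
      have L: "is_ideal L" "Q \<subseteq> L" "x \<in> L"
        unfolding L_def by (rule is_ideal_plus_principal[OF is_prime_idealD(1)[OF Q(1)]],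
            (rule plus_principal[OF is_prime_idealD(1)[OF Q(1)]])+)
      have "L \<inter> T \<noteq> {}"
      proof
        assume disj: "L \<inter> T = {}"
        have "1 \<in> T" "\<And>s t. s \<in> T \<Longrightarrow> t \<in> T \<Longrightarrow> s * t \<in> T"
          using T(1) unfolding mult_closed_def by blast+
        from prime_avoiding[OF noeth L(1) this disj]
        obtain Q' where Q': "is_prime_ideal Q'" "L \<subseteq> Q'" "Q' \<inter> T = {}" by blast
        have "Q \<subset> Q'" using L(2,3) Q'(2) x(2) by blast
        moreover have "Q' \<subseteq> P" using Q'(3) T(2) by blast
        ultimately have "Q' = P" by (rule Qmax[OF Q'(1)])
        with z T(3) Q'(3) show False by blast
      qed
      then obtain s j b where "s \<notin> P" "s * z ^ j - b * x \<in> Q"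
        unfolding L_def T_def by blast
      moreover have "s * z ^ j = (s * z ^ j - b * x) + b * x" by simp
      ultimately show ?thesis by blast
    qed
    then have ex: "\<exists>q. q \<in> Q \<and> (\<exists>s j b. s \<notin> P \<and> s * z ^ j = q + b * x)" if "z \<in> P" for z
      using that by simp
    define q where "q z = (SOME q. q \<in> Q \<and> (\<exists>s j b. s \<notin> P \<and> s * z ^ j = q + b * x))" for z
    have q: "q z \<in> Q \<and> (\<exists>s j b. s \<notin> P \<and> s * z ^ j = q z + b * x)" if "z \<in> P" for z
      unfolding q_def by (rule someI_ex[OF ex[OF that]])
    define X' where "X' = q ` (X - {x})"
    have X': "finite X'" "card X' \<le> e" "X' \<subseteq> Q"
    proof -
      show "finite X'" using Suc.prems(2) by (simp add: X'_def)
      have "card X' \<le> card (X - {x})"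
        unfolding X'_def using Suc.prems(2) by (intro card_image_le) simp
      also have "\<dots> \<le> e" using Suc.prems(2,3) x(1) by simp
      finally show "card X' \<le> e" .
      show "X' \<subseteq> Q" using q Suc.prems(4) unfolding X'_def by blast
    qed
    have Qmin: "Q' = Q" if Q': "is_prime_ideal Q'" "X' \<subseteq> Q'" "Q' \<subseteq> Q" for Q'
    proof (rule ccontr)
      assume "Q' \<noteq> Q"
      with Q'(3) have sub: "Q' \<subset> Q" by blast
      have "x \<in> P" using x(1) Suc.prems(4) by blast
      with principal_ideal_theorem[OF noeth Q'(1) Q(1) P sub Q(3)]
      obtain P' where P': "is_prime_ideal P'" "Q' \<subseteq> P'" "P' \<subseteq> P" "x \<in> P'" "P' \<noteq> P" by metis
      have "z \<in> P'" if z: "z \<in> X" for z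
      proof (cases "z = x")
        case False
        from z Suc.prems(4) q[of z] obtain s j b where s: "s \<notin> P" "s * z ^ j = q z + b * x" by blast
        have "q z \<in> P'" using z False Q'(2) P'(2) unfolding X'_def by blast
        with is_ideal_mult[OF is_prime_idealD(1)[OF P'(1)] P'(4)] have "s * z ^ j \<in> P'"
          unfolding s(2) by (intro is_ideal_add[OF is_prime_idealD(1)[OF P'(1)]])
        with s(1) P'(3) have "z ^ j \<in> P'"
          using is_prime_idealD(3)[OF P'(1), of s "z ^ j"] by blast
        then show ?thesis by (rule prime_power[OF P'(1)])
      qed (use P' in simp)
      with Suc.prems(5)[OF P'(1) _ P'(3)] P'(5) show False by blast
    qed
    define ps' where "ps' = ps(k' := Q)"
    have "k' \<le> e"
    proof (rule Suc.IH[OF Q(1) X' Qmin])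
      show "is_prime_ideal (ps' i)" if "i \<le> k'" for i
        using Suc.prems(6)[of i] Q(1) that Suc by (simp add: ps'_def)
      show "ps' i \<subset> ps' (Suc i)" if "i < k'" for i
        using Suc.prems(7)[of i] Q(2) that Suc by (auto simp: ps'_def)
      show "ps' k' = Q" by (simp add: ps'_def)
    qed
    with Suc show ?thesis by simp
  qed simp
qed

text \<open>
  A prime containing \<open>xs\<close> and the next element \<open>x\<close> contains a strictly smaller prime over \<open>xs\<close>: as \<open>x\<close> is regular
  modulo \<open>xs\<close>, the products \<open>s x\<^sup>k\<close> with \<open>s \<notin> P\<close> avoid the ideal of \<open>xs\<close>.
\<close>

lemma regular_sequence_chain:
  assumes noeth: "noetherian TYPE('a::comm_ring_1)"
  shows "is_prime_ideal P \<Longrightarrow> set xs \<subseteq> P \<Longrightarrow>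
    (\<forall>k<length xs. \<forall>a. xs ! k * a \<in> ideal_span (set (take k xs)) \<longrightarrow> a \<in> ideal_span (set (take k xs))) \<Longrightarrow>
    \<exists>ps :: nat \<Rightarrow> 'a set. (\<forall>i\<le>length xs. is_prime_ideal (ps i)) \<and> (\<forall>i<length xs. ps i \<subset> ps (Suc i)) \<and>
      ps (length xs) = P"
proof (induction xs arbitrary: P rule: rev_induct)
  case Nil
  then show ?case by (intro exI[of _ "\<lambda>_. P"]) simp
next
  case (snoc x xs)
  note S = mult_closed_compl_prime[OF snoc.prems(1)]
  define T where "T = {s * x ^ k | s k. s \<in> - P}"
  have T: "mult_closed T" "- P \<subseteq> T" "x \<in> T"
    unfolding T_def by (rule mult_closed_powers[OF S], rule powers_superset, rule powers_base[OF S])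
  have nzd: "a \<in> ideal_span (set xs)" if "x * a \<in> ideal_span (set xs)" for a
    using snoc.prems(3)[rule_format, of "length xs" a] that by (simp add: nth_append)
  have pow: "a \<in> ideal_span (set xs)" if "x ^ k * a \<in> ideal_span (set xs)" for k a
    using that by (induction k) (simp_all add: mult.assoc nzd)
  have sub: "ideal_span (set xs) \<subseteq> P"
    using snoc.prems(2) by (intro ideal_span_minimal[OF is_prime_idealD(1)[OF snoc.prems(1)]]) simp
  have disj: "ideal_span (set xs) \<inter> T = {}"
  proof -
    have False if "s \<notin> P" "s * x ^ k \<in> ideal_span (set xs)" for s k
    proof -
      have "s \<in> ideal_span (set xs)" by (rule pow[of k]) (use that(2) in \<open>simp add: mult.commute\<close>)
      with that(1) sub show False by blast
    qed
    then show ?thesis unfolding T_def by blast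
  qed
  have "1 \<in> T" "\<And>s t. s \<in> T \<Longrightarrow> t \<in> T \<Longrightarrow> s * t \<in> T"
    using T(1) unfolding mult_closed_def by blast+
  from prime_avoiding[OF noeth is_ideal_span this disj]
  obtain Q where Q: "is_prime_ideal Q" "ideal_span (set xs) \<subseteq> Q" "Q \<inter> T = {}" by blast
  have QP: "Q \<subset> P" using Q(3) T(2,3) snoc.prems(2) by auto
  have xsQ: "set xs \<subseteq> Q" using Q(2) ideal_span_base by blast
  have "xs ! k * a \<in> ideal_span (set (take k xs)) \<longrightarrow> a \<in> ideal_span (set (take k xs))"
    if "k < length xs" for k a
    using snoc.prems(3)[rule_format, of k a] that by (simp add: nth_append)
  with snoc.IH[OF Q(1) xsQ] obtain ps where ps: "\<forall>i\<le>length xs. is_prime_ideal (ps i)"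
    "\<forall>i<length xs. ps i \<subset> ps (Suc i)" "ps (length xs) = Q" by blast
  define ps' where "ps' = ps(Suc (length xs) := P)"
  have "(\<forall>i\<le>length (xs @ [x]). is_prime_ideal (ps' i)) \<and> (\<forall>i<length (xs @ [x]). ps' i \<subset> ps' (Suc i)) \<and>
      ps' (length (xs @ [x])) = P"
    using ps QP snoc.prems(1) by (auto simp: ps'_def less_Suc_eq le_Suc_eq)
  then show ?case by blast
qed

section \<open>Local rings\<close>

lemma noetherian_localD:
  assumes "noetherian_local \<mm>"
  shows "noetherian TYPE('a::comm_ring_1)" "is_ideal \<mm>" "1 \<notin> \<mm>"
    and "\<And>I. is_ideal I \<Longrightarrow> 1 \<notin> I \<Longrightarrow> I \<subseteq> (\<mm> :: 'a set)"
proof -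
  show noeth: "noetherian TYPE('a)"
    using assms by (simp add: noetherian_local_def)
  have max: "is_maximal_ideal M \<longleftrightarrow> M = \<mm>" for M
    using assms unfolding noetherian_local_def by blast
  have one: "1 \<notin> I \<longleftrightarrow> I \<noteq> UNIV" if "is_ideal I" for I :: "'a set"
    using is_ideal_mult[OF that, of 1] by auto
  from max[of \<mm>] show \<mm>: "is_ideal \<mm>" unfolding is_maximal_ideal_def by blast
  with max[of \<mm>] one show "1 \<notin> \<mm>" unfolding is_maximal_ideal_def by blast
  show "I \<subseteq> \<mm>" if I: "is_ideal I" "1 \<notin> I" for I
  proof -
    let ?F = "{J. is_ideal J \<and> I \<subseteq> J \<and> 1 \<notin> J}"
    have "\<exists>M\<in>?F. \<forall>J\<in>?F. M \<subseteq> J \<longrightarrow> J = M"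
      by (rule noetherian_maximal[OF noeth]) (use I in auto)
    then obtain M where M: "M \<in> ?F" "\<forall>J\<in>?F. M \<subseteq> J \<longrightarrow> J = M" ..
    have "is_maximal_ideal M"
      unfolding is_maximal_ideal_def using M one by blast
    with max M(1) show ?thesis by blast
  qed
qed

lemma local_unit:
  assumes "noetherian_local \<mm>" "a \<notin> \<mm>"
  shows "\<exists>b. b * a = (1 :: 'a::comm_ring_1)"
proof -
  have "a \<in> ideal_span {a}" by (rule ideal_span_base) simp
  with noetherian_localD(4)[OF assms(1), of "ideal_span {a}"] assms(2) have "1 \<in> ideal_span {a}"
    by auto
  then obtain b where "1 - b * a = 0"
    by (auto simp: ideal_span_insert)
  then show ?thesis by (metis eq_iff_diff_eq_0)
qed

lemma local_prime:
  assumes "noetherian_local \<mm>"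
  shows "is_prime_ideal (\<mm> :: 'a::comm_ring_1 set)"
  unfolding is_prime_ideal_def
proof (intro conjI allI impI)
  note D = noetherian_localD[OF assms]
  show "is_ideal \<mm>" by (rule D(2))
  show "\<mm> \<noteq> UNIV" using D(3) by blast
  fix a b assume ab: "a * b \<in> \<mm>"
  show "a \<in> \<mm> \<or> b \<in> \<mm>"
  proof (cases "a \<in> \<mm>")
    case False
    then obtain c where "c * a = 1" using local_unit[OF assms] by blast
    then have "c * (a * b) = b" by (simp flip: mult.assoc)
    with is_ideal_mult[OF D(2) ab, of c] show ?thesis by simp
  qed simp
qed

text \<open>
  Squeeze: the length of a regular sequence is at most the dimension, which is at most the number of generators
  of \<open>\<mm>\<close>.
\<close>

lemma regular_localI:
  assumes loc: "noetherian_local \<mm>" and X: "finite X" "ideal_span X = (\<mm> :: 'a::comm_ring_1 set)"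
    and xs: "regular_seq xs" "set xs \<subseteq> \<mm>" "card X \<le> length xs"
  shows "regular_local \<mm>"
proof -
  note D = noetherian_localD[OF loc]
  have le: "krull_dim TYPE('a) \<le> min_gens (*) \<mm>"
    unfolding krull_dim_def min_gens_def
  proof (intro Sup_least Inf_greatest, clarsimp)
    fix k and ps :: "nat \<Rightarrow> 'a set" and X :: "'a set"
    assume X: "finite X" "\<mm> = Modules.module.span (*) X"
      and ps: "\<forall>i\<le>k. is_prime_ideal (ps i)" "\<forall>i<k. ps i \<subset> ps (Suc i)"
    have X': "ideal_span X = \<mm>" using X(2) by (simp add: ideal_span_def)
    have "ps k \<subseteq> \<mm>"
      using D(4)[of "ps k"] is_prime_idealD(1,2)[of "ps k"] ps(1) by blast
    show "k \<le> card X"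
    proof (rule krull_height[OF D(1) local_prime[OF loc] X(1) order_refl, of k "ps(k := \<mm>)"])
      show "X \<subseteq> \<mm>" using ideal_span_base[of _ X] X' by blast
      show "Q = \<mm>" if "is_prime_ideal Q" "X \<subseteq> Q" "Q \<subseteq> \<mm>" for Q
        using ideal_span_minimal[OF is_prime_idealD(1)[OF that(1)] that(2)] X' that(3) by blast
      show "is_prime_ideal ((ps(k := \<mm>)) i)" if "i \<le> k" for i
        using ps(1) that local_prime[OF loc] by simp
      show "(ps(k := \<mm>)) i \<subset> (ps(k := \<mm>)) (Suc i)" if "i < k" for i
        using ps(2)[rule_format, of i] that \<open>ps k \<subseteq> \<mm>\<close> by auto
    qed simp
  qed
  have "min_gens (*) \<mm> \<le> enat (card X)"
    unfolding min_gens_def by (rule Inf_lower) (use X in \<open>auto simp: ideal_span_def\<close>)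
  also have "\<dots> \<le> enat (length xs)" using xs(3) by simp
  also have "\<dots> \<le> krull_dim TYPE('a)"
  proof -
    have "\<exists>ps :: nat \<Rightarrow> 'a set. (\<forall>i\<le>length xs. is_prime_ideal (ps i)) \<and> (\<forall>i<length xs. ps i \<subset> ps (Suc i)) \<and>
      ps (length xs) = \<mm>"
      by (rule regular_sequence_chain[OF D(1) local_prime[OF loc] xs(2)])
        (use xs(1) in \<open>simp add: regular_seq_def\<close>)
    then show ?thesis
      unfolding krull_dim_def by (intro Sup_upper) blast
  qed
  finally show ?thesis
    unfolding regular_local_def using loc le by simp
qed

text \<open>
  By Nakayama \<open>\<mm>\<close> would be principal. If \<open>x, y\<close> is a regular sequence and \<open>x = x' z\<close>, \<open>y = y' z\<close>, then
  \<open>y x' = y' x\<close>, so \<open>x' \<in> (x)\<close>, and \<open>x = x' z\<close> makes \<open>z\<close> a unit.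
\<close>

lemma local_not_principal:
  fixes \<mm> :: "'a::comm_ring_1 set"
  assumes loc: "noetherian_local \<mm>" and xs: "regular_seq xs" "set xs \<subseteq> \<mm>" "2 \<le> length xs"
    and gen: "\<And>w. w \<in> \<mm> \<Longrightarrow> \<exists>b. w - b * z \<in> ideal_span {p * q | p q. p \<in> \<mm> \<and> q \<in> \<mm>}"
    and z: "z \<in> \<mm>"
  shows False
proof -
  note D = noetherian_localD[OF loc]
  have unit: "u \<notin> \<mm> \<Longrightarrow> \<exists>b. b * u = 1" for u by (rule local_unit[OF loc])
  have "sat (- \<mm>) (ideal_span {z}) = ideal_span {z}"
  proof
    show "sat (- \<mm>) (ideal_span {z}) \<subseteq> ideal_span {z}"
    proof
      fix a assume "a \<in> sat (- \<mm>) (ideal_span {z})"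
      then obtain s where s: "s \<notin> \<mm>" "s * a \<in> ideal_span {z}" unfolding sat_def by blast
      obtain b where "b * s = 1" using unit[OF s(1)] by blast
      then have "b * (s * a) = a" by (simp flip: mult.assoc)
      with is_ideal_mult[OF is_ideal_span s(2), of b] show "a \<in> ideal_span {z}" by simp
    qed
  qed (rule sat_superset[OF mult_closed_compl_prime[OF local_prime[OF loc]]])
  moreover have "ideal_span {z} \<subseteq> \<mm>"
    using z by (intro ideal_span_minimal[OF D(2)]) simp
  ultimately have "\<mm> \<subseteq> ideal_span {z}"
  proof (rule saturated_Nakayama[OF D(1) local_prime[OF loc] is_ideal_span _ D(2)])
    fix a assume "a \<in> \<mm>"
    then obtain b where b: "a - b * z \<in> ideal_span {p * q | p q. p \<in> \<mm> \<and> q \<in> \<mm>}" using gen by blast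
    have "b * z \<in> ideal_span {z}"
      by (rule is_ideal_mult[OF is_ideal_span ideal_span_base]) simp
    with b show "a \<in> sat (- \<mm>) {b. \<exists>k\<in>ideal_span {z}. b - k \<in> ideal_span {p * q | p q. p \<in> \<mm> \<and> q \<in> \<mm>}}"
      by (intro subsetD[OF sat_superset[OF mult_closed_compl_prime[OF local_prime[OF loc]]]]) blast
  qed
  then have princ: "\<exists>b. w = b * z" if "w \<in> \<mm>" for w
    using that by (auto simp: ideal_span_insert)
  obtain x y ys where xs_eq: "xs = x # y # ys"
    using xs(3) by (metis Suc_le_length_iff numeral_2_eq_2)
  have regx: "a = 0" if "x * a = 0" for a
    using xs(1) that unfolding regular_seq_def xs_eq by (auto dest: spec[of _ 0])
  have regy: "a \<in> ideal_span {x}" if "y * a \<in> ideal_span {x}" for a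
    using xs(1) that unfolding regular_seq_def xs_eq by (auto dest: spec[of _ "Suc 0"])
  obtain x' y' where x': "x = x' * z" and y': "y = y' * z"
    using princ xs(2) unfolding xs_eq by (metis insert_subset list.simps(15))
  have "y * x' = y' * x"
    by (simp add: x' y' mult_ac)
  also have "\<dots> \<in> ideal_span {x}"
    by (rule is_ideal_mult[OF is_ideal_span ideal_span_base]) simp
  finally have "x' \<in> ideal_span {x}" by (rule regy)
  then obtain b where b: "x' = b * x" by (auto simp: ideal_span_insert)
  have "x * (1 - b * z) = 0"
    using x' b by (simp add: algebra_simps)
  from regx[OF this] have "1 = b * z" by simp
  with is_ideal_mult[OF D(2) z, of b] D(3) show False by simp
qed

section \<open>Minors and the annihilator of the cokernel\<close>

context column_matrix
begin

definition cokernel_annihilator :: "'a set" where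
  "cokernel_annihilator = {x. \<forall>k<r. \<exists>v. \<forall>l<r. (\<Sum>j<n. C l j * v j) = (if l = k then x else 0)}"

lemma is_ideal_cokernel_annihilator: "is_ideal cokernel_annihilator"
proof (rule is_idealI)
  show "0 \<in> cokernel_annihilator"
    unfolding cokernel_annihilator_def by (auto intro!: exI[of _ "\<lambda>_. 0"])
  show "x + y \<in> cokernel_annihilator" if "x \<in> cokernel_annihilator" "y \<in> cokernel_annihilator" for x y
    unfolding cokernel_annihilator_def
  proof (intro CollectI allI impI)
    fix k assume "k < r"
    with that obtain v w where "\<forall>l<r. (\<Sum>j<n. C l j * v j) = (if l = k then x else 0)"
      "\<forall>l<r. (\<Sum>j<n. C l j * w j) = (if l = k then y else 0)"
      unfolding cokernel_annihilator_def by blast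
    then show "\<exists>v. \<forall>l<r. (\<Sum>j<n. C l j * v j) = (if l = k then x + y else 0)"
      by (intro exI[of _ "\<lambda>j. v j + w j"]) (simp add: distrib_left sum.distrib)
  qed
  show "a * x \<in> cokernel_annihilator" if "x \<in> cokernel_annihilator" for a x
    unfolding cokernel_annihilator_def
  proof (intro CollectI allI impI)
    fix k assume "k < r"
    with that obtain v where "\<forall>l<r. (\<Sum>j<n. C l j * v j) = (if l = k then x else 0)"
      unfolding cokernel_annihilator_def by blast
    then show "\<exists>v. \<forall>l<r. (\<Sum>j<n. C l j * v j) = (if l = k then a * x else 0)"
      by (intro exI[of _ "\<lambda>j. a * v j"]) (simp add: mult.left_commute flip: sum_distrib_left)
  qed
qed

text \<open>
  Cramer's rule: the adjugate of the submatrix expresses its determinant times a basis vector in its columns.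
\<close>

lemma minors_subset_annihilator:
  "minors_ideal (mat r n (\<lambda>(i, j). C i j)) \<subseteq> cokernel_annihilator"
  unfolding minors_ideal_def
proof (rule ideal_span_minimal[OF is_ideal_cokernel_annihilator], rule subsetI)
  fix d assume "d \<in> {det (submatrix (mat r n (\<lambda>(i, j). C i j)) {..<dim_row (mat r n (\<lambda>(i, j). C i j))} J) |J.
    J \<subseteq> {..<dim_col (mat r n (\<lambda>(i, j). C i j))} \<and> card J = dim_row (mat r n (\<lambda>(i, j). C i j))}"
  then obtain J where d: "d = det (submatrix (mat r n (\<lambda>(i, j). C i j)) {..<r} J)"
    and J: "J \<subseteq> {..<n}" "card J = r"
    unfolding dim_row_mat dim_col_mat by blast
  define B where "B = submatrix (mat r n (\<lambda>(i, j). C i j)) {..<r} J"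
  have sets: "{i. i < r \<and> i \<in> {..<r}} = {..<r}" "{j. j < n \<and> j \<in> J} = J"
    using J by auto
  have dims: "dim_row B = r" "dim_col B = r"
    unfolding B_def dim_submatrix by (simp_all only: dim_row_mat dim_col_mat sets card_lessThan J)
  then have B: "B \<in> carrier_mat r r" by blast
  have pick: "pick J m < n" if "m < r" for m
    using pick_in_set_le[of m J] that J by auto
  have entry: "B $$ (l, m) = C l (pick J m)" if "l < r" "m < r" for l m
  proof -
    have "{a \<in> {..<r}. a < l} = {..<l}"
      using that(1) by auto
    then have "pick {..<r} l = l"
      using pick_card_in_set[of l "{..<r}"] that(1) by simp
    then show ?thesis
      unfolding B_def using that pick[OF that(2)] J sets by (subst submatrix_index) simp_all
  qed
  show "d \<in> cokernel_annihilator"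
    unfolding d B_def[symmetric] cokernel_annihilator_def
  proof (intro CollectI allI impI)
    fix k assume k: "k < r"
    define v where "v j = (\<Sum>m<r. if pick J m = j then adj_mat B $$ (m, k) else 0)" for j
    have "(\<Sum>j<n. C l j * v j) = (if l = k then det B else 0)" if l: "l < r" for l
    proof -
      have "(\<Sum>j<n. C l j * v j) = (\<Sum>m<r. \<Sum>j<n. if pick J m = j then C l j * adj_mat B $$ (m, k) else 0)"
        unfolding v_def sum_distrib_left by (subst sum.swap) (simp add: if_distrib cong: if_cong)
      also have "\<dots> = (\<Sum>m<r. B $$ (l, m) * adj_mat B $$ (m, k))"
        using pick entry[OF l] by (intro sum.cong) simp_all
      also have "\<dots> = (B * adj_mat B) $$ (l, k)"
        using B adj_mat(1)[OF B] l k by (simp add: times_mat_def scalar_prod_def lessThan_atLeast0)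
      also have "\<dots> = (if l = k then det B else 0)"
        unfolding adj_mat(2)[OF B] using l k by simp
      finally show ?thesis .
    qed
    then show "\<exists>v. \<forall>l<r. (\<Sum>j<n. C l j * v j) = (if l = k then det B else 0)" by blast
  qed
qed

end

lemma grade_attained:
  assumes "grade I = enat s" "0 < s"
  obtains xs where "set xs \<subseteq> I" "regular_seq xs" "s \<le> length xs"
proof (rule ccontr)
  note obtained = that
  assume "\<not> thesis"
  then have *: "length xs < s" if "set xs \<subseteq> I" "regular_seq xs" for xs
    using obtained[OF that] not_le_imp_less by blast
  have "grade I \<le> enat (s - 1)"
    unfolding grade_def
  proof (rule Sup_least)
    fix e assume "e \<in> {enat (length xs) | xs. set xs \<subseteq> I \<and> regular_seq xs}"
    then obtain xs where "e = enat (length xs)" "set xs \<subseteq> I" "regular_seq xs" by blast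
    with *[of xs] show "e \<le> enat (s - 1)" by simp
  qed
  with assms show False by simp
qed

section \<open>The socle module of a perfect matrix over a nonregular ring\<close>

text \<open>
  A vector \<open>x\<close> of \<open>A\<^sup>r\<close> represents an element of the socle module if all multiples \<open>w x\<close> with \<open>w \<in> \<mm>\<close> are
  combinations of the columns. Perfection of the matrix enters through the regular sequence \<open>xs\<close>.
\<close>

locale nonregular_perfect = column_matrix C r n
  for C :: "nat \<Rightarrow> nat \<Rightarrow> 'a::comm_ring_1" and r n :: nat +
  fixes \<mm> :: "'a set" and xs :: "'a list"
  assumes loc: "noetherian_local \<mm>" and not_regular: "\<not> regular_local \<mm>"
    and r: "0 < r" "r < n"
    and entries: "\<And>k j. k < r \<Longrightarrow> j < n \<Longrightarrow> C k j \<in> \<mm>"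
    and xs: "regular_seq xs" "set xs \<subseteq> \<mm>" "set xs \<subseteq> cokernel_annihilator" "n - r + 1 \<le> length xs"
begin

lemma annihilating_vectors:
  "x \<in> set xs \<Longrightarrow> \<exists>v. \<forall>k<r. \<forall>l<r. (\<Sum>j<n. C l j * v k j) = (if l = k then x else 0)"
proof -
  assume "x \<in> set xs"
  with xs(3) have "\<forall>k. \<exists>v. k < r \<longrightarrow> (\<forall>l<r. (\<Sum>j<n. C l j * v j) = (if l = k then x else 0))"
    unfolding cokernel_annihilator_def by blast
  then have "\<exists>v. \<forall>k. k < r \<longrightarrow> (\<forall>l<r. (\<Sum>j<n. C l j * v k j) = (if l = k then x else 0))"
    by (rule choice)
  then show ?thesis by blast
qed

lemma syzygy_entries:
  assumes "\<And>k. k < r \<Longrightarrow> (\<Sum>j<n. C k j * u j) = 0"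
  shows "\<exists>g. \<forall>j<n. u j = bds r g (\<lambda>_. 0) {j}"
  by (rule syzygy_in_image[OF xs(1) _ xs(4) annihilating_vectors assms]) (use r in auto)

lemma syzygy_annihilates:
  assumes "\<And>k. k < r \<Longrightarrow> (\<Sum>j<n. C k j * u j) = 0" "j < n"
  shows "u j \<in> cokernel_annihilator"
proof -
  obtain g where "u j = bds r g (\<lambda>_. 0) {j}"
    using syzygy_entries[OF assms(1)] assms(2) by blast
  then show ?thesis
    unfolding cokernel_annihilator_def using image_entry_kills_cokernel by simp
qed

text \<open>
  This is \<open>\<mm>M \<subseteq> \<mm>N\<close>. A coefficient outside \<open>\<mm>\<close> would make \<open>\<mm>\<close> too small for a ring that is not regular: comparing
  two multiples of \<open>x\<close> gives syzygies that express each \<open>w \<in> \<mm>\<close> by \<open>z\<close> and an entry of the Buchsbaum-Rim complex.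
\<close>

lemma socle_coefficients:
  assumes x: "\<And>w. w \<in> \<mm> \<Longrightarrow> \<exists>s. \<forall>k<r. w * x k = (\<Sum>j<n. C k j * s j)"
    and z: "z \<in> \<mm>" and u: "\<And>k. k < r \<Longrightarrow> z * x k = (\<Sum>j<n. C k j * u j)" and i: "i < n"
  shows "u i \<in> \<mm>"
proof (rule ccontr)
  assume "u i \<notin> \<mm>"
  then obtain b where b: "b * u i = 1"
    using local_unit[OF loc] by blast
  note \<mm> = noetherian_localD(2)[OF loc]
  have repr: "\<exists>s g. w - (b * s) * z = - (b * bds r g (\<lambda>_. 0) {i})" if w: "w \<in> \<mm>" for w
  proof -
    obtain s where s: "\<And>k. k < r \<Longrightarrow> w * x k = (\<Sum>j<n. C k j * s j)"
      using x[OF w] by blast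
    have "(\<Sum>j<n. C k j * (z * s j - w * u j)) = 0" if "k < r" for k
    proof -
      have "(\<Sum>j<n. C k j * (z * s j - w * u j)) = z * (\<Sum>j<n. C k j * s j) - w * (\<Sum>j<n. C k j * u j)"
        by (simp add: sum_distrib_left right_diff_distrib sum_subtractf mult_ac)
      also have "\<dots> = z * (w * x k) - w * (z * x k)"
        using s[OF that] u[OF that] by simp
      finally show ?thesis by (simp add: mult.left_commute)
    qed
    from syzygy_entries[OF this] i obtain g where g: "z * s i - w * u i = bds r g (\<lambda>_. 0) {i}"
      by blast
    have "w - (b * s i) * z = w * (b * u i) - (b * s i) * z" by (simp add: b)
    also have "\<dots> = - (b * (z * s i - w * u i))" by (simp add: algebra_simps)
    finally show ?thesis unfolding g by blast
  qed
  show False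
  proof (cases "r = 1")
    case True
    define X where "X = insert z (C 0 ` ({..<n} - {i}))"
    have "finite X" by (simp add: X_def)
    have "X \<subseteq> \<mm>"
      using z entries r(1) by (auto simp: X_def)
    then have "ideal_span X \<subseteq> \<mm>"
      by (rule ideal_span_minimal[OF \<mm>])
    moreover have "\<mm> \<subseteq> ideal_span X"
    proof
      fix w assume "w \<in> \<mm>"
      from repr[OF this] obtain s g where eq: "w - (b * s) * z = - (b * bds r g (\<lambda>_. 0) {i})" by blast
      have "- (b * bds r g (\<lambda>_. 0) {i}) \<in> ideal_span (C 0 ` ({..<n} - {i}))"
        by (rule is_ideal_minus[OF is_ideal_span is_ideal_mult[OF is_ideal_span image_entry_single_row[OF True]]])
      then have "w - (b * s) * z \<in> ideal_span (C 0 ` ({..<n} - {i}))"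
        unfolding eq .
      then show "w \<in> ideal_span X"
        unfolding X_def ideal_span_insert by blast
    qed
    ultimately have "ideal_span X = \<mm>" by blast
    moreover have "card X \<le> length xs"
    proof -
      have "card X \<le> Suc (card (C 0 ` ({..<n} - {i})))"
        unfolding X_def by (simp add: card_insert_if)
      also have "\<dots> \<le> Suc (card ({..<n} - {i}))"
        using card_image_le[of "{..<n} - {i}" "C 0"] by simp
      also have "\<dots> \<le> length xs"
        using i xs(4) True r(2) by simp
      finally show ?thesis .
    qed
    ultimately show False
      using regular_localI[OF loc _ _ xs(1,2), of X] not_regular \<open>finite X\<close> by blast
  next
    case False
    with r(1) have "2 \<le> r" by simp
    show False
    proof (rule local_not_principal[OF loc xs(1,2) _ _ z])
      show "2 \<le> length xs" using xs(4) r(2) by linarith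
      fix w assume "w \<in> \<mm>"
      from repr[OF this] obtain s g where eq: "w - (b * s) * z = - (b * bds r g (\<lambda>_. 0) {i})" by blast
      have "- (b * bds r g (\<lambda>_. 0) {i}) \<in> ideal_span {p * q | p q. p \<in> \<mm> \<and> q \<in> \<mm>}"
        by (rule is_ideal_minus[OF is_ideal_span is_ideal_mult[OF is_ideal_span
                image_entry_in_square[OF \<mm> entries \<open>2 \<le> r\<close>]]])
      then have "w - (b * s) * z \<in> ideal_span {p * q | p q. p \<in> \<mm> \<and> q \<in> \<mm>}"
        unfolding eq .
      then show "\<exists>b. w - b * z \<in> ideal_span {p * q | p q. p \<in> \<mm> \<and> q \<in> \<mm>}"
        by blast
    qed
  qed
qed

text \<open>
  This is \<open>M \<subseteq> \<mm>F\<close>. A unit coordinate of \<open>x\<close> would give \<open>\<mm> = \<mm>\<^sup>2\<close>, which is the forbidden case \<open>\<mm> = (z) + \<mm>\<^sup>2\<close>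
  for \<open>z = 0\<close>.
\<close>

lemma socle_in_maximal:
  assumes x: "\<And>w. w \<in> \<mm> \<Longrightarrow> \<exists>s. \<forall>k<r. w * x k = (\<Sum>j<n. C k j * s j)" and k: "k < r"
  shows "x k \<in> \<mm>"
proof (rule ccontr)
  assume "x k \<notin> \<mm>"
  then obtain b where b: "b * x k = 1"
    using local_unit[OF loc] by blast
  let ?m2 = "ideal_span {p * q | p q. p \<in> \<mm> \<and> q \<in> \<mm>}"
  show False
  proof (rule local_not_principal[OF loc xs(1,2)])
    show "2 \<le> length xs" using xs(4) r(2) by linarith
    show "0 \<in> \<mm>" by (rule is_ideal_zero[OF noetherian_localD(2)[OF loc]])
    fix w assume w: "w \<in> \<mm>"
    then obtain s where s: "\<And>k. k < r \<Longrightarrow> w * x k = (\<Sum>j<n. C k j * s j)"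
      using x by blast
    have "C k j * s j \<in> ?m2" if "j < n" for j
      using entries[OF k that] socle_coefficients[OF x w s that] by (intro ideal_span_base) blast
    then have "w * x k \<in> ?m2"
      unfolding s[OF k] by (intro is_ideal_sum[OF is_ideal_span]) simp
    from is_ideal_mult[OF is_ideal_span this, of b] have "w * (b * x k) \<in> ?m2"
      by (simp only: mult.left_commute)
    then have "w \<in> ?m2"
      unfolding b by simp
    then have "w - 0 * 0 \<in> ?m2" by simp
    then show "\<exists>b. w - b * 0 \<in> ?m2" by blast
  qed
qed

end

section \<open>Free modules\<close>

locale based_module = Modules.module scale
  for scale :: "'a::comm_ring_1 \<Rightarrow> 'f::ab_group_add \<Rightarrow> 'f" +
  fixes r :: nat and t :: "nat \<Rightarrow> 'f"
  assumes basis: "free_basis scale r t"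
begin

abbreviation crd :: "'f \<Rightarrow> nat \<Rightarrow> 'a" where
  "crd \<equiv> coord scale r t"

lemma basis': "inj_on t {..<r}" "independent (t ` {..<r})" "span (t ` {..<r}) = UNIV"
  using basis unfolding free_basis_def by auto

lemma crd_add: "crd (x + y) i = crd x i + crd y i"
  unfolding coord_def using representation_add[OF basis'(2), of y x] basis'(3) by simp

lemma crd_scale: "crd (scale a x) i = a * crd x i"
  unfolding coord_def using representation_scale[OF basis'(2), of x a] basis'(3) by simp

lemma crd_0: "crd 0 i = 0"
  using crd_scale[of 0 0 i] by simp

lemma crd_sum: "crd (\<Sum>j\<in>A. f j) i = (\<Sum>j\<in>A. crd (f j) i)"
  by (induction A rule: infinite_finite_induct) (simp_all add: crd_0 crd_add)

lemma crd_basis: "k < r \<Longrightarrow> i < r \<Longrightarrow> crd (t k) i = (if i = k then 1 else 0)"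
  unfolding coord_def using representation_basis[OF basis'(2), of "t k"] basis'(1)
  by (auto simp: inj_on_def)

lemma expansion: "x = (\<Sum>k<r. scale (crd x k) (t k))"
proof -
  have "(\<Sum>b\<in>t ` {..<r}. scale (representation (t ` {..<r}) x b) b) = x"
    by (rule sum_representation_eq[OF basis'(2)]) (use basis'(3) in auto)
  then show ?thesis
    unfolding coord_def sum.reindex[OF basis'(1)] by simp
qed

lemma crd_eqI: "(\<And>k. k < r \<Longrightarrow> crd x k = crd y k) \<Longrightarrow> x = y"
  by (subst expansion[of x], subst expansion[of y]) simp

lemma span_family: "x \<in> span (c ` {..<n}) \<longleftrightarrow> (\<exists>u. x = (\<Sum>j<n. scale (u j) (c j)))" for n :: nat
proof
  assume "x \<in> span (c ` {..<n})"
  then show "\<exists>u. x = (\<Sum>j<n. scale (u j) (c j))"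
  proof (induction rule: span_induct_alt)
    case base
    show ?case by (intro exI[of _ "\<lambda>_. 0"]) simp
  next
    case (step a y z)
    then obtain i u where i: "i < n" "y = c i" and z: "z = (\<Sum>j<n. scale (u j) (c j))" by blast
    have "scale a y = (\<Sum>j<n. scale (if j = i then a else 0) (c j))"
      using i by (simp add: if_distrib[of "\<lambda>a. scale a _"] cong: if_cong)
    then have "scale a y + z = (\<Sum>j<n. scale ((if j = i then a else 0) + u j) (c j))"
      unfolding z by (simp add: scale_left_distrib sum.distrib)
    then show ?case by (intro exI[of _ "\<lambda>j. (if j = i then a else 0) + u j"])
  qed
qed (auto intro: span_sum span_scale span_base)

lemma span_family_crd:
  "x \<in> span (c ` {..<n}) \<longleftrightarrow> (\<exists>u. \<forall>k<r. crd x k = (\<Sum>j<n. crd (c j) k * u j))" for n :: nat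
proof -
  have "x = (\<Sum>j<n. scale (u j) (c j)) \<longleftrightarrow> (\<forall>k<r. crd x k = (\<Sum>j<n. crd (c j) k * u j))" for u
  proof -
    have *: "crd (\<Sum>j<n. scale (u j) (c j)) k = (\<Sum>j<n. crd (c j) k * u j)" for k
      by (simp add: crd_sum crd_scale mult.commute)
    show ?thesis
      unfolding *[symmetric] by (auto intro: crd_eqI)
  qed
  then show ?thesis unfolding span_family by simp
qed

abbreviation emb :: "'f \<Rightarrow> 'a polys" where
  "emb \<equiv> sym_embed scale r t"

interpretation polys: Modules.module "poly_scale :: 'a \<Rightarrow> 'a polys \<Rightarrow> 'a polys"
  by (rule module_poly_scale)

lemma emb_scale: "emb (scale a x) = poly_scale a (emb x)"
  unfolding sym_embed_def by (simp add: crd_scale polys.scale_sum_right)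

lemma emb_add: "emb (x + y) = emb x + emb y"
  unfolding sym_embed_def by (simp add: crd_add polys.scale_left_distrib sum.distrib)

lemma emb_0: "emb 0 = 0"
  using emb_scale[of 0 0] by simp

lemma emb_sum: "emb (\<Sum>j\<in>A. f j) = (\<Sum>j\<in>A. emb (f j))"
  by (induction A rule: infinite_finite_induct) (simp_all add: emb_0 emb_add)

lemma poly_scale_mult: "poly_scale a p * q = poly_scale a (p * q)" "p * poly_scale a q = poly_scale a (p * q)"
  by (simp_all add: poly_scale_def mult_ac)

text \<open>
  In the symmetric algebra \<open>x y = \<Sum>\<^sub>k (y\<^sub>k x) t\<^sub>k\<close>; expanding the \<open>y\<^sub>k x\<close> in the \<open>c\<^sub>i\<close> and collecting the
  coefficients of each \<open>c\<^sub>i\<close> gives the second factor.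
\<close>

lemma emb_mult_as_sum:
  fixes n :: nat
  assumes "\<And>k. k < r \<Longrightarrow> scale (crd y k) x = (\<Sum>i<n. scale (b k i) (c i))"
  shows "emb x * emb y = (\<Sum>i<n. emb (c i) * emb (\<Sum>k<r. scale (b k i) (t k)))"
proof -
  have "emb x * emb y = (\<Sum>k<r. emb (scale (crd y k) x) * emb (t k))"
    by (subst expansion[of y]) (simp add: emb_sum emb_scale sum_distrib_left poly_scale_mult)
  also have "\<dots> = (\<Sum>k<r. \<Sum>i<n. poly_scale (b k i) (emb (c i) * emb (t k)))"
    using assms by (simp add: emb_sum emb_scale sum_distrib_right poly_scale_mult)
  also have "\<dots> = (\<Sum>i<n. emb (c i) * emb (\<Sum>k<r. scale (b k i) (t k)))"
    by (subst sum.swap) (simp add: emb_sum emb_scale sum_distrib_left poly_scale_mult)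
  finally show ?thesis .
qed

lemma crd_ideal_smult:
  assumes I: "is_ideal I" and x: "x \<in> ideal_smult scale I UNIV"
  shows "crd x k \<in> I"
  using x unfolding ideal_smult_def
proof (induction rule: span_induct_alt)
  case base
  show ?case using is_ideal_zero[OF I] by (simp add: crd_0)
next
  case (step a y z)
  then obtain b f where "y = scale b f" "b \<in> I" by blast
  then have "crd (scale a y) k \<in> I"
    using is_ideal_mult[OF I is_ideal_mult_right[OF I \<open>b \<in> I\<close>], of a "crd f k"] by (simp add: crd_scale mult.assoc)
  with step show ?case using is_ideal_add[OF I] by (simp add: crd_add)
qed

end

section \<open>The equality of products\<close>

theorem theorem4p2:
  fixes \<mm> :: "'a::comm_ring_1 set"
    and scale :: "'a \<Rightarrow> 'f::ab_group_add \<Rightarrow> 'f"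
    and r n :: nat
    and t c :: "nat \<Rightarrow> 'f"
    and N M :: "'f set"
  assumes "noetherian_local \<mm>"
    and "Modules.module scale"
    and "0 < r" and "free_basis scale r t"
    and "N = Modules.module.span scale (c ` {..<n})"
    and "enat n = min_gens scale N"
    and "r < n"
    and "M = module_colon scale N \<mm>"
    and "perfect_mat (assoc_mat scale r t n c)"
    and "N \<subseteq> ideal_smult scale \<mm> UNIV"
    and "0 < depth_local \<mm>"
    and "\<not> regular_local \<mm>"
  shows "sym_prod scale r t M M = sym_prod scale r t N M"
proof -
  interpret F: based_module scale r t
    using assms(2,4) unfolding based_module_def based_module_axioms_def by blast
  interpret polys: Modules.module "poly_scale :: 'a \<Rightarrow> 'a polys \<Rightarrow> 'a polys"
    by (rule module_poly_scale)
  note \<mm> = noetherian_localD(2)[OF assms(1)]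
  define C where "C k j = F.crd (c j) k" for k j
  interpret column_matrix C r n .
  have N: "N = F.span (c ` {..<n})" by (rule assms(5))
  have subN: "F.subspace N" unfolding N by simp
  have c: "c j \<in> N" if "j < n" for j
    unfolding N using that by (intro F.span_base) simp
  have N_iff: "x \<in> N \<longleftrightarrow> (\<exists>u. \<forall>k<r. F.crd x k = (\<Sum>j<n. C k j * u j))" for x
    unfolding N C_def by (rule F.span_family_crd)
  have mat: "assoc_mat scale r t n c = mat r n (\<lambda>(i, j). C i j)"
    by (simp add: assoc_mat_def C_def)
  have perf: "minors_ideal (mat r n (\<lambda>(i, j). C i j)) \<noteq> UNIV"
    "grade (minors_ideal (mat r n (\<lambda>(i, j). C i j))) = enat (n - r + 1)"
    using assms(9) unfolding perfect_mat_def mat by auto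
  from grade_attained[OF perf(2)] obtain xs where
    xs: "set xs \<subseteq> minors_ideal (mat r n (\<lambda>(i, j). C i j))" "regular_seq xs" "n - r + 1 \<le> length xs"
    by auto
  have minors: "minors_ideal (mat r n (\<lambda>(i, j). C i j)) \<subseteq> \<mm>"
  proof (rule noetherian_localD(4)[OF assms(1)])
    show ideal: "is_ideal (minors_ideal (mat r n (\<lambda>(i, j). C i j)))"
      unfolding minors_ideal_def by simp
    show "1 \<notin> minors_ideal (mat r n (\<lambda>(i, j). C i j))"
      using is_ideal_mult[OF ideal, of 1] perf(1) by auto
  qed
  interpret nonregular_perfect C r n \<mm> xs
  proof (unfold_locales; (fact assms xs)?)
    show "C k j \<in> \<mm>" if "j < n" for k j
      unfolding C_def using F.crd_ideal_smult[OF \<mm>] c[OF that] assms(10) by blast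
    show "set xs \<subseteq> \<mm>" using xs(1) minors by blast
    show "set xs \<subseteq> cokernel_annihilator" using xs(1) minors_subset_annihilator by blast
  qed
  have NM: "N \<subseteq> M"
    unfolding assms(8) module_colon_def using F.subspace_scale[OF subN] by blast
  have M_crd: "\<exists>s. \<forall>k<r. w * F.crd x k = (\<Sum>j<n. C k j * s j)" if "x \<in> M" "w \<in> \<mm>" for x w
  proof -
    have "scale w x \<in> N" using that unfolding assms(8) module_colon_def by blast
    then show ?thesis unfolding N_iff F.crd_scale .
  qed
  have ann_N: "scale a f \<in> N" if "a \<in> cokernel_annihilator" for a f
  proof -
    have "scale a (t k) \<in> N" if "k < r" for k
    proof -
      from \<open>a \<in> cokernel_annihilator\<close> that obtain v
        where v: "\<And>l. l < r \<Longrightarrow> (\<Sum>j<n. C l j * v j) = (if l = k then a else 0)"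
        unfolding cokernel_annihilator_def by blast
      then have "\<forall>l<r. F.crd (scale a (t k)) l = (\<Sum>j<n. C l j * v j)"
        using that by (simp add: F.crd_scale F.crd_basis)
      then show ?thesis unfolding N_iff by blast
    qed
    then have "(\<Sum>k<r. scale (F.crd f k) (scale a (t k))) \<in> N"
      by (intro F.subspace_sum[OF subN], intro F.subspace_scale[OF subN, of "scale a (t _)"]) simp
    moreover have "(\<Sum>k<r. scale (F.crd f k) (scale a (t k))) = scale a f"
      by (subst (2) F.expansion[of f]) (simp add: F.scale_sum_right mult.commute)
    ultimately show ?thesis by simp
  qed
  have product: "F.emb x * F.emb y \<in> sym_prod scale r t N M" if x: "x \<in> M" and y: "y \<in> M" for x y
  proof -
    have "\<exists>b. \<forall>l<r. F.crd y k * F.crd x l = (\<Sum>i<n. C l i * b i)" if "k < r" for k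
      using M_crd[OF x socle_in_maximal[OF M_crd[OF y] that]] .
    then have "\<forall>k. \<exists>b. k < r \<longrightarrow> (\<forall>l<r. F.crd y k * F.crd x l = (\<Sum>i<n. C l i * b i))"
      by blast
    from choice[OF this] obtain b
      where b: "\<And>k l. k < r \<Longrightarrow> l < r \<Longrightarrow> F.crd y k * F.crd x l = (\<Sum>i<n. C l i * b k i)" by blast
    \<comment> \<open>the cofactor of \<open>c i\<close> in the product of \<open>x\<close> and \<open>y\<close>; the point is that it lies in \<open>M\<close>\<close>
    define g where "g i = (\<Sum>k<r. scale (b k i) (t k))" for i
    have "scale (F.crd y k) x = (\<Sum>i<n. scale (b k i) (c i))" if "k < r" for k
    proof (rule F.crd_eqI)
      fix l assume "l < r"
      show "F.crd (scale (F.crd y k) x) l = F.crd (\<Sum>i<n. scale (b k i) (c i)) l"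
        unfolding F.crd_scale F.crd_sum b[OF that \<open>l < r\<close>] C_def by (simp only: mult.commute)
    qed
    then have sum: "F.emb x * F.emb y = (\<Sum>i<n. F.emb (c i) * F.emb (g i))"
      unfolding g_def by (rule F.emb_mult_as_sum)
    have "g i \<in> M" if i: "i < n" for i
      unfolding assms(8) module_colon_def
    proof (intro CollectI ballI)
      fix z assume z: "z \<in> \<mm>"
      then obtain u where u: "\<And>k. k < r \<Longrightarrow> z * F.crd x k = (\<Sum>j<n. C k j * u j)"
        using M_crd[OF x] by blast
      have ui: "u i \<in> \<mm>"
        by (rule socle_coefficients[OF M_crd[OF x] z u i])
      \<comment> \<open>for fixed k both parts, paired with the columns, give the coordinates of z y_k x\<close>
      have "z * b k i - u i * F.crd y k \<in> cokernel_annihilator" if k: "k < r" for k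
      proof (rule syzygy_annihilates[OF _ i, of "\<lambda>i. z * b k i - u i * F.crd y k"])
        fix l assume l: "l < r"
        have "(\<Sum>j<n. C l j * (z * b k j - u j * F.crd y k))
            = z * (\<Sum>j<n. C l j * b k j) - F.crd y k * (\<Sum>j<n. C l j * u j)"
          by (simp add: sum_distrib_left right_diff_distrib sum_subtractf mult_ac)
        also have "\<dots> = z * (F.crd y k * F.crd x l) - F.crd y k * (z * F.crd x l)"
          by (simp only: b[OF k l] u[OF l])
        finally show "(\<Sum>j<n. C l j * (z * b k j - u j * F.crd y k)) = 0"
          by (simp add: mult_ac)
      qed
      then have "(\<Sum>k<r. scale (z * b k i - u i * F.crd y k) (t k)) \<in> N"
        by (intro F.subspace_sum[OF subN] ann_N) simp
      moreover have "scale (u i) y \<in> N"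
        using y ui unfolding assms(8) module_colon_def by blast
      ultimately have "(\<Sum>k<r. scale (z * b k i - u i * F.crd y k) (t k)) + scale (u i) y \<in> N"
        by (rule F.subspace_add[OF subN])
      moreover have "scale z (g i) = (\<Sum>k<r. scale (z * b k i - u i * F.crd y k) (t k)) + scale (u i) y"
        by (subst F.expansion[of y])
          (simp add: g_def F.scale_sum_right F.scale_left_diff_distrib sum_subtractf)
      ultimately show "scale z (g i) \<in> N" by simp
    qed
    then show ?thesis
      unfolding sum sym_prod_def using c by (intro polys.span_sum polys.span_base) auto
  qed
  show ?thesis
  proof
    show "sym_prod scale r t M M \<subseteq> sym_prod scale r t N M"
      unfolding sym_prod_def[of scale r t M M]
      by (rule polys.span_minimal) (use product in \<open>auto simp: sym_prod_def\<close>)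
    show "sym_prod scale r t N M \<subseteq> sym_prod scale r t M M"
      unfolding sym_prod_def by (rule polys.span_mono) (use NM in blast)
  qed
qed

end
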